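(* On noncompact Riemannian manifolds, global Jacobi does not imply solenoidal, and global Jacobi together with solenoidal does not imply Killing. That is: (i) there exist a noncompact Riemannian manifold $M$ and a smooth vector field $X$ on $M$ such that $X$ is a global Jacobi field but is not solenoidal; (ii) there exist a noncompact Riemannian manifold $M$ and a smooth vector field $X$ on $M$ such that $X$ is both a global Jacobi field and solenoidal but is not Killing.
   Context: Manifolds are smooth and without boundary. Let $\nabla$ be the Levi-Civita connection and $R_{V,W}=\nabla_V\nabla_W-\nabla_W\nabla_V-\nabla_{[V,W]}$ the curvature. A vector field $X$ is Killing if $L_Xg=0$, where $g$ is the metric. It is called a global Jacobi field if its restriction to every geodesic $\gamma$ of $M$ is a Jacobi field along $\gamma$, i.e. $\nabla_{\dot\gamma}\nabla_{\dot\gamma}X=R_{\dot\gamma,X}\dot\gamma$ along $\gamma$. It is called solenoidal if $\operatorname{div}X=0$ on $M$, where $\operatorname{div}X$ is the trace of $V\mapsto\nabla_VX$. *)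

theory Defs
  imports "HOL-Analysis.Analysis" "HOL-Library.Function_Algebras"
begin

section \<open>Smooth functions on open subsets of R^n\<close>

text \<open>
  R^n is the library space \<^term>\<open>Euclidean_space n\<close>, whose points are the functions
  \<^typ>\<open>nat \<Rightarrow> real\<close> vanishing at all indices from \<^term>\<open>n\<close> on.  Hence the dimension is an
  ordinary number and can be part of the data of a manifold.
\<close>

definition partial_deriv :: "nat \<Rightarrow> ((nat \<Rightarrow> real) \<Rightarrow> real) \<Rightarrow> (nat \<Rightarrow> real) \<Rightarrow> real" where
  "partial_deriv i f x = deriv (\<lambda>t. f (x(i := t))) (x i)"

text \<open>
  For \<^term>\<open>U\<close> open in R^n: all iterated partial derivatives (including that of order 0) exist
  and are continuous on \<^term>\<open>U\<close>.  Values of \<^term>\<open>f\<close> outside \<^term>\<open>U\<close> do not matter.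
\<close>

definition smooth_on_open :: "nat \<Rightarrow> (nat \<Rightarrow> real) set \<Rightarrow> ((nat \<Rightarrow> real) \<Rightarrow> real) \<Rightarrow> bool" where
  "smooth_on_open n U f \<longleftrightarrow>
     (\<forall>js. set js \<subseteq> {..<n} \<longrightarrow>
        continuous_map (subtopology (Euclidean_space n) U) euclideanreal (foldr partial_deriv js f) \<and>
        (\<forall>x\<in>U. \<forall>i<n. (\<lambda>t. foldr partial_deriv js f (x(i := t))) field_differentiable (at (x i))))"

definition smooth_on_line :: "real set \<Rightarrow> (real \<Rightarrow> real) \<Rightarrow> bool" where
  "smooth_on_line J f \<longleftrightarrow> (\<forall>k. \<forall>t\<in>J. (deriv ^^ k) f field_differentiable (at t))"


section \<open>Smooth manifolds and tangent vectors\<close>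

text \<open>A chart is a pair of its domain and its coordinate map.\<close>

type_synonym 'a chart = "'a set \<times> ('a \<Rightarrow> nat \<Rightarrow> real)"

text \<open>
  A tangent vector at a point is given by its components in each chart of the atlas around that
  point, subject to the usual transformation law (see \<open>tangent_space\<close> below).
\<close>

type_synonym 'a tvec = "'a chart \<Rightarrow> nat \<Rightarrow> real"
type_synonym 'a vfield = "'a \<Rightarrow> 'a tvec"

record 'a riemannian =
  mtop :: "'a topology"
  mdim :: nat
  matlas :: "'a chart set"
  mmetric :: "'a \<Rightarrow> 'a tvec \<Rightarrow> 'a tvec \<Rightarrow> real"

definition chart_inv :: "'a chart \<Rightarrow> (nat \<Rightarrow> real) \<Rightarrow> 'a" where
  "chart_inv c = inv_into (fst c) (snd c)"

definition is_chart :: "'a topology \<Rightarrow> nat \<Rightarrow> 'a chart \<Rightarrow> bool" where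
  "is_chart T n c \<longleftrightarrow>
     openin T (fst c) \<and> openin (Euclidean_space n) (snd c ` fst c) \<and>
     homeomorphic_map (subtopology T (fst c)) (subtopology (Euclidean_space n) (snd c ` fst c)) (snd c)"

definition smooth_manifold :: "'a riemannian \<Rightarrow> bool" where
  "smooth_manifold M \<longleftrightarrow>
     Hausdorff_space (mtop M) \<and> second_countable (mtop M) \<and>
     (\<forall>c\<in>matlas M. is_chart (mtop M) (mdim M) c) \<and>
     topspace (mtop M) = (\<Union>c\<in>matlas M. fst c) \<and>
     (\<forall>c\<in>matlas M. \<forall>d\<in>matlas M. \<forall>i<mdim M.
        smooth_on_open (mdim M) (snd c ` (fst c \<inter> fst d)) (\<lambda>x. snd d (chart_inv c x) i))"

definition charts_at :: "'a riemannian \<Rightarrow> 'a \<Rightarrow> 'a chart set" where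
  "charts_at M p = {c \<in> matlas M. p \<in> fst c}"

definition chart_at :: "'a riemannian \<Rightarrow> 'a \<Rightarrow> 'a chart" where
  "chart_at M p = (SOME c. c \<in> charts_at M p)"

definition transition_jacobian ::
    "'a chart \<Rightarrow> 'a chart \<Rightarrow> 'a \<Rightarrow> nat \<Rightarrow> nat \<Rightarrow> real" where
  "transition_jacobian c d p i j = partial_deriv j (\<lambda>x. snd d (chart_inv c x) i) (snd c p)"

text \<open>
  Components in charts that are not around \<^term>\<open>p\<close> are set to 0, so that tangent vectors are
  equal iff they agree as functions; for \<^term>\<open>p\<close> outside the manifold only the zero function
  remains.
\<close>

definition tangent_space :: "'a riemannian \<Rightarrow> 'a \<Rightarrow> 'a tvec set" where
  "tangent_space M p =
     {v. (\<forall>c. c \<notin> charts_at M p \<longrightarrow> v c = 0) \<and>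
         (\<forall>c\<in>charts_at M p. v c \<in> topspace (Euclidean_space (mdim M))) \<and>
         (\<forall>c\<in>charts_at M p. \<forall>d\<in>charts_at M p. \<forall>i<mdim M.
            v d i = (\<Sum>j<mdim M. transition_jacobian c d p i j * v c j))}"

definition tscale :: "real \<Rightarrow> 'a tvec \<Rightarrow> 'a tvec" (infixr \<open>*\<^sub>T\<close> 75) where
  "a *\<^sub>T v = (\<lambda>c i. a * v c i)"

text \<open>The coordinate basis vector of the \<^term>\<open>j\<close>-th coordinate of the chart \<^term>\<open>c\<close> at \<^term>\<open>p\<close>.\<close>

definition coord_vec :: "'a riemannian \<Rightarrow> 'a chart \<Rightarrow> nat \<Rightarrow> 'a \<Rightarrow> 'a tvec" where
  "coord_vec M c j p =
     (\<lambda>d i. if d \<in> charts_at M p \<and> i < mdim M then transition_jacobian c d p i j else 0)"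

definition smooth_fun :: "'a riemannian \<Rightarrow> ('a \<Rightarrow> real) \<Rightarrow> bool" where
  "smooth_fun M f \<longleftrightarrow>
     (\<forall>c\<in>matlas M. smooth_on_open (mdim M) (snd c ` fst c) (\<lambda>x. f (chart_inv c x)))"

definition dir_deriv :: "'a riemannian \<Rightarrow> 'a \<Rightarrow> 'a tvec \<Rightarrow> ('a \<Rightarrow> real) \<Rightarrow> real" where
  "dir_deriv M p v f =
     (let c = chart_at M p
      in \<Sum>j<mdim M. v c j * partial_deriv j (\<lambda>x. f (chart_inv c x)) (snd c p))"

definition vector_fields :: "'a riemannian \<Rightarrow> 'a vfield set" where
  "vector_fields M =
     {X. (\<forall>p. X p \<in> tangent_space M p) \<and>
         (\<forall>c\<in>matlas M. \<forall>i<mdim M.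
            smooth_on_open (mdim M) (snd c ` fst c) (\<lambda>x. X (chart_inv c x) c i))}"

definition lie_bracket :: "'a riemannian \<Rightarrow> 'a vfield \<Rightarrow> 'a vfield \<Rightarrow> 'a vfield" where
  "lie_bracket M X Y =
     (\<lambda>p c i. if c \<in> charts_at M p \<and> i < mdim M then
        (\<Sum>j<mdim M.
            X p c j * partial_deriv j (\<lambda>x. Y (chart_inv c x) c i) (snd c p)
          - Y p c j * partial_deriv j (\<lambda>x. X (chart_inv c x) c i) (snd c p)) else 0)"

text \<open>A vector field extending a given tangent vector; one exists by means of a bump function.\<close>

definition extend_tvec :: "'a riemannian \<Rightarrow> 'a \<Rightarrow> 'a tvec \<Rightarrow> 'a vfield" where
  "extend_tvec M p v = (SOME V. V \<in> vector_fields M \<and> V p = v)"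


section \<open>Riemannian metrics, Levi-Civita connection, curvature\<close>

definition riemannian_manifold :: "'a riemannian \<Rightarrow> bool" where
  "riemannian_manifold M \<longleftrightarrow>
     smooth_manifold M \<and>
     (\<forall>p\<in>topspace (mtop M). \<forall>u\<in>tangent_space M p. \<forall>v\<in>tangent_space M p.
        mmetric M p u v = mmetric M p v u \<and>
        (\<forall>w\<in>tangent_space M p. mmetric M p (u + v) w = mmetric M p u w + mmetric M p v w) \<and>
        (\<forall>a. mmetric M p (a *\<^sub>T u) v = a * mmetric M p u v) \<and>
        (u \<noteq> 0 \<longrightarrow> mmetric M p u u > 0)) \<and>
     (\<forall>c\<in>matlas M. \<forall>i<mdim M. \<forall>j<mdim M.
        smooth_on_open (mdim M) (snd c ` fst c)
          (\<lambda>x. mmetric M (chart_inv c x)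
                 (coord_vec M c i (chart_inv c x)) (coord_vec M c j (chart_inv c x))))"

definition affine_connection ::
    "'a riemannian \<Rightarrow> ('a vfield \<Rightarrow> 'a vfield \<Rightarrow> 'a vfield) \<Rightarrow> bool" where
  "affine_connection M nab \<longleftrightarrow>
     (\<forall>X\<in>vector_fields M. \<forall>Y\<in>vector_fields M.
        nab X Y \<in> vector_fields M \<and>
        (\<forall>Z\<in>vector_fields M. nab (X + Y) Z = nab X Z + nab Y Z \<and> nab Z (X + Y) = nab Z X + nab Z Y) \<and>
        (\<forall>f. smooth_fun M f \<longrightarrow>
           nab (\<lambda>p. f p *\<^sub>T X p) Y = (\<lambda>p. f p *\<^sub>T nab X Y p) \<and>
           nab X (\<lambda>p. f p *\<^sub>T Y p) = (\<lambda>p. f p *\<^sub>T nab X Y p + dir_deriv M p (X p) f *\<^sub>T Y p)))"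

definition is_levi_civita ::
    "'a riemannian \<Rightarrow> ('a vfield \<Rightarrow> 'a vfield \<Rightarrow> 'a vfield) \<Rightarrow> bool" where
  "is_levi_civita M nab \<longleftrightarrow>
     affine_connection M nab \<and>
     (\<forall>X\<in>vector_fields M. \<forall>Y\<in>vector_fields M. nab X Y - nab Y X = lie_bracket M X Y) \<and>
     (\<forall>X\<in>vector_fields M. \<forall>Y\<in>vector_fields M. \<forall>Z\<in>vector_fields M. \<forall>p\<in>topspace (mtop M).
        dir_deriv M p (X p) (\<lambda>q. mmetric M q (Y q) (Z q)) =
        mmetric M p (nab X Y p) (Z p) + mmetric M p (Y p) (nab X Z p))"

text \<open>
  By the fundamental theorem of Riemannian geometry the connection exists and is unique as an
  operation on \<^term>\<open>vector_fields M\<close>, so the choice is immaterial.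
\<close>

definition levi_civita :: "'a riemannian \<Rightarrow> 'a vfield \<Rightarrow> 'a vfield \<Rightarrow> 'a vfield" where
  "levi_civita M = (SOME nab. is_levi_civita M nab)"

text \<open>
  The values of the covariant derivative and of the curvature at a point depend only on
  the values there of the arguments entering tensorially, so the extensions do not matter.
\<close>

definition nabla_at :: "'a riemannian \<Rightarrow> 'a \<Rightarrow> 'a tvec \<Rightarrow> 'a vfield \<Rightarrow> 'a tvec" where
  "nabla_at M p v X = levi_civita M (extend_tvec M p v) X p"

definition curvature :: "'a riemannian \<Rightarrow> 'a vfield \<Rightarrow> 'a vfield \<Rightarrow> 'a vfield \<Rightarrow> 'a vfield" where
  "curvature M V W Z =
     levi_civita M V (levi_civita M W Z) - levi_civita M W (levi_civita M V Z)
     - levi_civita M (lie_bracket M V W) Z"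

definition curvature_at ::
    "'a riemannian \<Rightarrow> 'a \<Rightarrow> 'a tvec \<Rightarrow> 'a tvec \<Rightarrow> 'a tvec \<Rightarrow> 'a tvec" where
  "curvature_at M p v w z =
     curvature M (extend_tvec M p v) (extend_tvec M p w) (extend_tvec M p z) p"


section \<open>Curves, geodesics and Jacobi fields\<close>

definition smooth_curve :: "'a riemannian \<Rightarrow> real set \<Rightarrow> (real \<Rightarrow> 'a) \<Rightarrow> bool" where
  "smooth_curve M I \<gamma> \<longleftrightarrow>
     open I \<and> is_interval I \<and> I \<noteq> {} \<and>
     continuous_map (top_of_set I) (mtop M) \<gamma> \<and>
     (\<forall>c\<in>matlas M. \<forall>i<mdim M. smooth_on_line {t\<in>I. \<gamma> t \<in> fst c} (\<lambda>t. snd c (\<gamma> t) i))"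

definition velocity :: "'a riemannian \<Rightarrow> (real \<Rightarrow> 'a) \<Rightarrow> real \<Rightarrow> 'a tvec" where
  "velocity M \<gamma> t =
     (\<lambda>c i. if c \<in> charts_at M (\<gamma> t) \<and> i < mdim M then deriv (\<lambda>s. snd c (\<gamma> s) i) t else 0)"

definition fields_along ::
    "'a riemannian \<Rightarrow> real set \<Rightarrow> (real \<Rightarrow> 'a) \<Rightarrow> (real \<Rightarrow> 'a tvec) set" where
  "fields_along M I \<gamma> =
     {Y. (\<forall>t\<in>I. Y t \<in> tangent_space M (\<gamma> t)) \<and>
         (\<forall>c\<in>matlas M. \<forall>i<mdim M. smooth_on_line {t\<in>I. \<gamma> t \<in> fst c} (\<lambda>t. Y t c i))}"

definition is_cov_deriv_along ::
    "'a riemannian \<Rightarrow> real set \<Rightarrow> (real \<Rightarrow> 'a) \<Rightarrow> ((real \<Rightarrow> 'a tvec) \<Rightarrow> real \<Rightarrow> 'a tvec) \<Rightarrow> bool" where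
  "is_cov_deriv_along M I \<gamma> D \<longleftrightarrow>
     (\<forall>Y\<in>fields_along M I \<gamma>.
        D Y \<in> fields_along M I \<gamma> \<and>
        (\<forall>Z\<in>fields_along M I \<gamma>. \<forall>t\<in>I. D (Y + Z) t = D Y t + D Z t) \<and>
        (\<forall>f. smooth_on_line I f \<longrightarrow>
           (\<forall>t\<in>I. D (\<lambda>s. f s *\<^sub>T Y s) t = f t *\<^sub>T D Y t + deriv f t *\<^sub>T Y t))) \<and>
     (\<forall>X\<in>vector_fields M. \<forall>t\<in>I.
        D (\<lambda>s. X (\<gamma> s)) t = nabla_at M (\<gamma> t) (velocity M \<gamma> t) X)"

text \<open>
  For a smooth curve these axioms determine \<^term>\<open>D Y t\<close> uniquely for all fields
  \<^term>\<open>Y\<close> along the curve and \<^term>\<open>t \<in> I\<close>, and such an operator exists.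
\<close>

definition cov_deriv_along ::
    "'a riemannian \<Rightarrow> real set \<Rightarrow> (real \<Rightarrow> 'a) \<Rightarrow> (real \<Rightarrow> 'a tvec) \<Rightarrow> real \<Rightarrow> 'a tvec" where
  "cov_deriv_along M I \<gamma> = (SOME D. is_cov_deriv_along M I \<gamma> D)"

definition geodesic :: "'a riemannian \<Rightarrow> real set \<Rightarrow> (real \<Rightarrow> 'a) \<Rightarrow> bool" where
  "geodesic M I \<gamma> \<longleftrightarrow>
     smooth_curve M I \<gamma> \<and> (\<forall>t\<in>I. cov_deriv_along M I \<gamma> (velocity M \<gamma>) t = 0)"

definition jacobi_field_along ::
    "'a riemannian \<Rightarrow> real set \<Rightarrow> (real \<Rightarrow> 'a) \<Rightarrow> (real \<Rightarrow> 'a tvec) \<Rightarrow> bool" where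
  "jacobi_field_along M I \<gamma> J \<longleftrightarrow>
     J \<in> fields_along M I \<gamma> \<and>
     (\<forall>t\<in>I. cov_deriv_along M I \<gamma> (cov_deriv_along M I \<gamma> J) t =
             curvature_at M (\<gamma> t) (velocity M \<gamma> t) (J t) (velocity M \<gamma> t))"


section \<open>Global Jacobi, solenoidal and Killing vector fields\<close>

definition global_jacobi :: "'a riemannian \<Rightarrow> 'a vfield \<Rightarrow> bool" where
  "global_jacobi M X \<longleftrightarrow>
     (\<forall>I \<gamma>. geodesic M I \<gamma> \<longrightarrow> jacobi_field_along M I \<gamma> (\<lambda>t. X (\<gamma> t)))"

text \<open>The trace of an endomorphism of the tangent space at \<^term>\<open>p\<close>, in a coordinate basis.\<close>

definition tangent_trace :: "'a riemannian \<Rightarrow> 'a \<Rightarrow> ('a tvec \<Rightarrow> 'a tvec) \<Rightarrow> real" where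
  "tangent_trace M p L =
     (let c = chart_at M p in \<Sum>i<mdim M. L (coord_vec M c i p) c i)"

definition divergence :: "'a riemannian \<Rightarrow> 'a vfield \<Rightarrow> 'a \<Rightarrow> real" where
  "divergence M X p = tangent_trace M p (\<lambda>v. nabla_at M p v X)"

definition solenoidal :: "'a riemannian \<Rightarrow> 'a vfield \<Rightarrow> bool" where
  "solenoidal M X \<longleftrightarrow> (\<forall>p\<in>topspace (mtop M). divergence M X p = 0)"

definition lie_deriv_metric ::
    "'a riemannian \<Rightarrow> 'a vfield \<Rightarrow> 'a vfield \<Rightarrow> 'a vfield \<Rightarrow> 'a \<Rightarrow> real" where
  "lie_deriv_metric M X Y Z p =
     dir_deriv M p (X p) (\<lambda>q. mmetric M q (Y q) (Z q))
     - mmetric M p (lie_bracket M X Y p) (Z p) - mmetric M p (Y p) (lie_bracket M X Z p)"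

definition killing :: "'a riemannian \<Rightarrow> 'a vfield \<Rightarrow> bool" where
  "killing M X \<longleftrightarrow>
     (\<forall>Y\<in>vector_fields M. \<forall>Z\<in>vector_fields M. \<forall>p\<in>topspace (mtop M).
        lie_deriv_metric M X Y Z p = 0)"

definition noncompact_riemannian_manifold :: "'a riemannian \<Rightarrow> bool" where
  "noncompact_riemannian_manifold M \<longleftrightarrow> riemannian_manifold M \<and> \<not> compact_space (mtop M)"

text \<open>
  Existence of a manifold is stated over the point type \<^typ>\<open>nat \<Rightarrow> real\<close>.  This loses
  nothing: a second countable Hausdorff space has at most continuum many points, so every manifold
  is isomorphic to one whose points are taken from this type.
\<close>

type_synonym riem = "(nat \<Rightarrow> real) riemannian"

end

theory Submission
  imports Defs
begin

text \<open>
  In flat space geodesics are affinely parametrised lines and the curvature vanishes, so the Jacobi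
  equation only asks for the second derivative along lines to be zero.  Every linear vector field
  \<open>p \<mapsto> A p\<close> satisfies it, while its divergence is the trace of \<open>A\<close> and it is Killing only if \<open>A\<close>
  is skew.  In the plane take \<open>A = diag (1, 1)\<close> for (i) and \<open>A = diag (1, -1)\<close> for (ii).
\<close>

section \<open>Smooth functions on the whole of R^n\<close>

text \<open>The connection, the covariant derivative along a curve and the extension of a tangent
  vector are all chosen by \<open>SOME\<close> from axioms. To compute with them, the axioms must
  first be shown to have a solution, and the chosen object must then be shown to agree with it on
  smooth arguments. Hence the existence and uniqueness proofs for the Levi-Civita connection and for
  differentiation along curves. A chosen extension is an arbitrary smooth field with a prescribed
  value at one point, not a constant field; so even flatness requires symmetry of second partial
  derivatives. The axiom that ties differentiation along a curve to the connection requires the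
  chain rule. Smoothness is expressed only by iterated partial derivatives, so both facts are
  derived from these. Two is the least dimension in which a nonzero diagonal matrix can have trace
  zero, as (ii) demands; the same plane serves (i).\<close>

abbreviation Rn :: "nat \<Rightarrow> (nat \<Rightarrow> real) set" where
  "Rn n \<equiv> topspace (Euclidean_space n)"

abbreviation smooth :: "nat \<Rightarrow> ((nat \<Rightarrow> real) \<Rightarrow> real) \<Rightarrow> bool" where
  "smooth n \<equiv> smooth_on_open n (Rn n)"

text \<open>A recursive form of k-fold continuous differentiability. It splits off the derivative
  taken first, so that sums and products can be handled by induction on k with the functions
  generalised.\<close>

primrec cdiff :: "nat \<Rightarrow> nat \<Rightarrow> ((nat \<Rightarrow> real) \<Rightarrow> real) \<Rightarrow> bool" where
  "cdiff n 0 f \<longleftrightarrow> continuous_on (Rn n) f"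
| "cdiff n (Suc k) f \<longleftrightarrow> continuous_on (Rn n) f \<and>
     (\<forall>i<n. (\<forall>x\<in>Rn n. (\<lambda>t. f (x(i := t))) field_differentiable (at (x i))) \<and>
        cdiff n k (partial_deriv i f))"

lemma fun_upd_in_Rn: "x \<in> Rn n \<Longrightarrow> i < n \<Longrightarrow> x(i := t) \<in> Rn n"
  by (auto simp: topspace_Euclidean_space)

lemma partial_deriv_cong:
  assumes "\<And>y. y \<in> Rn n \<Longrightarrow> f y = g y" "x \<in> Rn n" "i < n"
  shows "partial_deriv i f x = partial_deriv i g x"
  using assms by (simp add: partial_deriv_def fun_upd_in_Rn)

text \<open>Functions here are total on \<open>nat \<Rightarrow> real\<close>, but the sum and
  product rules for \<open>partial_deriv\<close> are available only on \<open>Rn n\<close>. This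
  lemma lets such restricted equations be used under \<open>cdiff\<close>.\<close>

lemma cdiff_cong:
  assumes "\<And>y. y \<in> Rn n \<Longrightarrow> f y = g y"
  shows "cdiff n k f \<longleftrightarrow> cdiff n k g"
  using assms
proof (induction k arbitrary: f g)
  case 0
  then show ?case by (simp cong: continuous_on_cong_simp)
next
  case (Suc k)
  have "continuous_on (Rn n) f \<longleftrightarrow> continuous_on (Rn n) g"
    using Suc.prems by (simp cong: continuous_on_cong_simp)
  moreover have "cdiff n k (partial_deriv i f) \<longleftrightarrow> cdiff n k (partial_deriv i g)" if "i < n" for i
    by (rule Suc.IH) (use that Suc.prems partial_deriv_cong in blast)
  ultimately show ?case
    using Suc.prems by (simp add: fun_upd_in_Rn)
qed

lemma cdiff_Suc_imp: "cdiff n (Suc k) f \<Longrightarrow> cdiff n k f"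
  by (induction k arbitrary: f) auto

lemma cdiff_imp_continuous_on: "cdiff n k f \<Longrightarrow> continuous_on (Rn n) f"
  by (cases k) auto

text \<open>\<open>foldr\<close> applies the last index of the list first, whereas
  \<open>cdiff\<close> recurses on the derivative taken first. Lists of indices are therefore
  extended and inducted upon at their end.\<close>

lemma smooth_iff_cdiff: "smooth n f \<longleftrightarrow> (\<forall>k. cdiff n k f)"
proof
  assume "smooth n f"
  then show "\<forall>k. cdiff n k f"
  proof (intro allI)
    fix k
    from \<open>smooth n f\<close> show "cdiff n k f"
    proof (induction k arbitrary: f)
      case 0
      then show ?case
        by (auto simp: smooth_on_open_def continuous_map_Euclidean_space_iff dest: spec[of _ "[]"])
    next
      case (Suc k)
      have "smooth n (partial_deriv i f)" if "i < n" for i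
        unfolding smooth_on_open_def
      proof (intro allI impI)
        fix js assume "set js \<subseteq> {..<n}"
        then show "continuous_map (subtopology (Euclidean_space n) (Rn n)) euclideanreal
               (foldr partial_deriv js (partial_deriv i f)) \<and>
              (\<forall>x\<in>Rn n. \<forall>ia<n. (\<lambda>t. foldr partial_deriv js (partial_deriv i f) (x(ia := t)))
                field_differentiable at (x ia))"
          using Suc.prems \<open>i < n\<close> unfolding smooth_on_open_def
          by (auto dest!: spec[of _ "js @ [i]"])
      qed
      then show ?case
        using Suc.IH Suc.prems
        by (auto simp: smooth_on_open_def continuous_map_Euclidean_space_iff dest: spec[of _ "[]"])
    qed
  qed
next
  assume f: "\<forall>k. cdiff n k f"
  have "continuous_on (Rn n) (foldr partial_deriv js f) \<and>
      (\<forall>x\<in>Rn n. \<forall>i<n. (\<lambda>t. foldr partial_deriv js f (x(i := t))) field_differentiable (at (x i)))"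
    if "set js \<subseteq> {..<n}" for js
    using f that
  proof (induction js arbitrary: f rule: rev_induct)
    case Nil
    then have "cdiff n (Suc 0) f" by blast
    then show ?case by (simp del: fun_upd_apply)
  next
    case (snoc j js)
    then have "\<forall>k. cdiff n (Suc k) f" by blast
    with snoc show ?case by simp
  qed
  then show "smooth n f"
    unfolding smooth_on_open_def by (simp add: continuous_map_Euclidean_space_iff)
qed

lemma smooth_cong:
  assumes "\<And>y. y \<in> Rn n \<Longrightarrow> f y = g y"
  shows "smooth n f \<longleftrightarrow> smooth n g"
  by (simp add: smooth_iff_cdiff cdiff_cong[of n f g, OF assms])

lemma smooth_imp_continuous_on: "smooth n f \<Longrightarrow> continuous_on (Rn n) f"
  using cdiff_imp_continuous_on smooth_iff_cdiff by blast

lemma smooth_partial_deriv: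
  assumes "smooth n f" "i < n"
  shows "smooth n (partial_deriv i f)"
proof -
  have "cdiff n (Suc k) f" for k
    using assms by (simp only: smooth_iff_cdiff)
  with assms(2) show ?thesis by (simp add: smooth_iff_cdiff)
qed

lemma smooth_imp_field_differentiable:
  assumes "smooth n f" "i < n" "x \<in> Rn n"
  shows "(\<lambda>t. f (x(i := t))) field_differentiable (at (x i))"
proof -
  have "cdiff n (Suc 0) f"
    using assms by (simp only: smooth_iff_cdiff)
  with assms show ?thesis by simp
qed

lemma smooth_has_partial_deriv:
  assumes "smooth n f" "i < n" "x \<in> Rn n"
  shows "((\<lambda>t. f (x(i := t))) has_real_derivative partial_deriv i f (x(i := s))) (at s)"
  using smooth_imp_field_differentiable[OF assms(1,2) fun_upd_in_Rn[OF assms(3,2)], of s]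
  by (simp add: partial_deriv_def DERIV_deriv_iff_field_differentiable)

section \<open>Closure properties of smooth functions\<close>

lemma cdiff_const: "cdiff n k (\<lambda>x. c)"
proof (induction k arbitrary: c)
  case (Suc k)
  have "partial_deriv i (\<lambda>x. c) = (\<lambda>x. 0)" for i :: nat
    by (auto simp: partial_deriv_def)
  with Suc show ?case by simp
qed simp

lemma smooth_const [simp]: "smooth n (\<lambda>x. c)"
  by (simp add: smooth_iff_cdiff cdiff_const)

lemma partial_deriv_coord: "partial_deriv i (\<lambda>x. x j) x = (if i = j then 1 else 0)"
  by (simp add: partial_deriv_def)

lemma smooth_coord [simp]: "smooth n (\<lambda>x. x j)"
proof -
  have "cdiff n k (\<lambda>x. x j)" for k
  proof (cases k)
    case (Suc m)
    have "partial_deriv i (\<lambda>x. x j) = (\<lambda>x. if i = j then 1 else 0)" for i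
      by (simp add: partial_deriv_coord fun_eq_iff)
    moreover have "(\<lambda>t. if j = i then t else c) field_differentiable (at s)" for i and c s :: real
      by (cases "i = j") auto
    ultimately show ?thesis
      by (simp add: Suc cdiff_const continuous_on_subset[OF continuous_on_product_coordinates])
  qed (simp add: continuous_on_subset[OF continuous_on_product_coordinates])
  then show ?thesis by (simp add: smooth_iff_cdiff)
qed

lemma cdiff_add: "cdiff n k f \<Longrightarrow> cdiff n k g \<Longrightarrow> cdiff n k (\<lambda>x. f x + g x)"
proof (induction k arbitrary: f g)
  case 0
  then show ?case by (simp add: continuous_on_add)
next
  case (Suc k)
  have "cdiff n k (partial_deriv i (\<lambda>x. f x + g x))" if "i < n" for i
  proof -
    have "cdiff n k (\<lambda>x. partial_deriv i f x + partial_deriv i g x)"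
      using Suc that by simp
    moreover have "partial_deriv i (\<lambda>x. f x + g x) x = partial_deriv i f x + partial_deriv i g x"
      if "x \<in> Rn n" for x
      using Suc.prems that \<open>i < n\<close> by (simp add: partial_deriv_def deriv_add)
    ultimately show ?thesis by (subst cdiff_cong) auto
  qed
  with Suc.prems show ?case
    by (simp add: continuous_on_add field_differentiable_add)
qed

lemma cdiff_mult: "cdiff n k f \<Longrightarrow> cdiff n k g \<Longrightarrow> cdiff n k (\<lambda>x. f x * g x)"
proof (induction k arbitrary: f g)
  case 0
  then show ?case by (simp add: continuous_on_mult)
next
  case (Suc k)
  have "cdiff n k (partial_deriv i (\<lambda>x. f x * g x))" if "i < n" for i
  proof -
    \<comment> \<open>The product rule keeps one factor undifferentiated; it is \<open>Suc k\<close>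
      times differentiable and has to be weakened to k for the induction hypothesis.\<close>
    have "cdiff n k (\<lambda>x. f x * partial_deriv i g x + partial_deriv i f x * g x)"
      using Suc.prems that by (intro cdiff_add Suc.IH) (auto intro: cdiff_Suc_imp)
    moreover have "partial_deriv i (\<lambda>x. f x * g x) x
        = f x * partial_deriv i g x + partial_deriv i f x * g x" if "x \<in> Rn n" for x
      using Suc.prems that \<open>i < n\<close> by (simp add: partial_deriv_def deriv_mult)
    ultimately show ?thesis by (subst cdiff_cong) auto
  qed
  with Suc.prems show ?case
    by (simp add: continuous_on_mult field_differentiable_mult)
qed

lemma smooth_add: "smooth n f \<Longrightarrow> smooth n g \<Longrightarrow> smooth n (\<lambda>x. f x + g x)"
  by (simp add: smooth_iff_cdiff cdiff_add)

lemma smooth_mult: "smooth n f \<Longrightarrow> smooth n g \<Longrightarrow> smooth n (\<lambda>x. f x * g x)"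
  by (simp add: smooth_iff_cdiff cdiff_mult)

lemma smooth_diff: "smooth n f \<Longrightarrow> smooth n g \<Longrightarrow> smooth n (\<lambda>x. f x - g x)"
  using smooth_add[of n f "\<lambda>x. -1 * g x"] smooth_mult[of n "\<lambda>x. -1" g] by simp

lemma smooth_sum:
  assumes "\<And>j. j \<in> A \<Longrightarrow> smooth n (f j)"
  shows "smooth n (\<lambda>x. \<Sum>j\<in>A. f j x)"
  using assms by (induction A rule: infinite_finite_induct) (auto intro: smooth_add)

lemma partial_deriv_add:
  assumes "smooth n f" "smooth n g" "i < n" "x \<in> Rn n"
  shows "partial_deriv i (\<lambda>x. f x + g x) x = partial_deriv i f x + partial_deriv i g x"
  using assms by (simp add: partial_deriv_def smooth_imp_field_differentiable)

lemma partial_deriv_mult: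
  assumes "smooth n f" "smooth n g" "i < n" "x \<in> Rn n"
  shows "partial_deriv i (\<lambda>x. f x * g x) x = f x * partial_deriv i g x + partial_deriv i f x * g x"
  using assms by (simp add: partial_deriv_def smooth_imp_field_differentiable)

text \<open>The mean value theorem is applied twice: in u to the increment of F over [b, b + h],
  then in v to \<open>Fx\<close>. The second difference on the left does not depend on which
  variable is treated first, which is what makes it useful for comparing the two mixed
  derivatives.\<close>

lemma mixed_difference_mvt:
  fixes F :: "real \<Rightarrow> real \<Rightarrow> real"
  assumes "\<And>u v. ((\<lambda>u. F u v) has_real_derivative Fx u v) (at u)"
    and "\<And>u v. ((\<lambda>v. Fx u v) has_real_derivative Fxy u v) (at v)"
    and "h > 0"
  obtains \<xi> \<eta> where "a < \<xi>" "\<xi> < a + h" "b < \<eta>" "\<eta> < b + h"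
    "F (a + h) (b + h) - F (a + h) b - F a (b + h) + F a b = h * h * Fxy \<xi> \<eta>"
proof -
  have "((\<lambda>u. F u (b + h) - F u b) has_real_derivative Fx u (b + h) - Fx u b) (at u)" for u
    using assms(1) by (intro derivative_intros)
  then obtain \<xi> where \<xi>: "a < \<xi>" "\<xi> < a + h"
    "(F (a + h) (b + h) - F (a + h) b) - (F a (b + h) - F a b) = h * (Fx \<xi> (b + h) - Fx \<xi> b)"
    using MVT2[of a "a + h" "\<lambda>u. F u (b + h) - F u b" "\<lambda>u. Fx u (b + h) - Fx u b"] \<open>h > 0\<close>
    by auto
  obtain \<eta> where \<eta>: "b < \<eta>" "\<eta> < b + h" "Fx \<xi> (b + h) - Fx \<xi> b = h * Fxy \<xi> \<eta>"
    using MVT2[of b "b + h" "Fx \<xi>" "Fxy \<xi>"] assms(2) \<open>h > 0\<close> by auto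
  show thesis
    by (rule that[OF \<xi>(1,2) \<eta>(1,2)]) (use \<xi>(3) \<eta>(3) in \<open>simp add: algebra_simps\<close>)
qed

text \<open>One and the same second difference over a small square is \<open>h * h\<close> times a
  value of \<open>Fxy\<close> and \<open>h * h\<close> times a value of \<open>Fyx\<close>, both
  taken inside the square. Continuity then forces equality at the corner.\<close>

lemma schwarz_symmetry:
  fixes F :: "real \<Rightarrow> real \<Rightarrow> real"
  assumes 1: "\<And>u v. ((\<lambda>u. F u v) has_real_derivative Fx u v) (at u)"
    and 2: "\<And>u v. ((\<lambda>v. F u v) has_real_derivative Fy u v) (at v)"
    and 12: "\<And>u v. ((\<lambda>v. Fx u v) has_real_derivative Fxy u v) (at v)"
    and 21: "\<And>u v. ((\<lambda>u. Fy u v) has_real_derivative Fyx u v) (at u)"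
    and c12: "continuous_on UNIV (\<lambda>(u, v). Fxy u v)"
    and c21: "continuous_on UNIV (\<lambda>(u, v). Fyx u v)"
  shows "Fxy a b = Fyx a b"
proof (rule ccontr)
  \<comment> \<open>Half the gap: a common value within \<open>e\<close> of both
    \<open>Fxy a b\<close> and \<open>Fyx a b\<close> would make the gap less than
    \<open>2 * e\<close>, which is the gap itself.\<close>
  define e where "e = \<bar>Fxy a b - Fyx a b\<bar> / 2"
  assume "Fxy a b \<noteq> Fyx a b"
  then have "e > 0" by (simp add: e_def)
  obtain d1 where d1: "d1 > 0" "\<And>p. dist p (a, b) < d1 \<Longrightarrow> dist (case p of (u, v) \<Rightarrow> Fxy u v) (Fxy a b) < e"
    using c12 \<open>e > 0\<close> unfolding continuous_on_iff by fastforce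
  obtain d2 where d2: "d2 > 0" "\<And>p. dist p (a, b) < d2 \<Longrightarrow> dist (case p of (u, v) \<Rightarrow> Fyx u v) (Fyx a b) < e"
    using c21 \<open>e > 0\<close> unfolding continuous_on_iff by fastforce
  \<comment> \<open>Points of the square are at distance less than \<open>2 * h\<close> from its
    corner, and dividing by 3 puts this below both radii.\<close>
  define h where "h = min d1 d2 / 3"
  have "h > 0" using d1 d2 by (simp add: h_def)
  have near: "dist (\<xi>, \<eta>) (a, b) < d1 \<and> dist (\<xi>, \<eta>) (a, b) < d2"
    if "a < \<xi>" "\<xi> < a + h" "b < \<eta>" "\<eta> < b + h" for \<xi> \<eta>
  proof -
    have "dist (\<xi>, \<eta>) (a, b) \<le> dist \<xi> a + dist \<eta> b"
      by (simp add: dist_Pair_Pair sqrt_sum_squares_le_sum)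
    also have "\<dots> < 2 * h" using that by (simp add: dist_real_def)
    finally show ?thesis using \<open>h > 0\<close> by (auto simp: h_def)
  qed
  obtain \<xi> \<eta> where x: "a < \<xi>" "\<xi> < a + h" "b < \<eta>" "\<eta> < b + h"
    "F (a + h) (b + h) - F (a + h) b - F a (b + h) + F a b = h * h * Fxy \<xi> \<eta>"
    using mixed_difference_mvt[OF 1 12 \<open>h > 0\<close>] by blast
  obtain \<eta>' \<xi>' where y: "b < \<eta>'" "\<eta>' < b + h" "a < \<xi>'" "\<xi>' < a + h"
    "F (a + h) (b + h) - F a (b + h) - F (a + h) b + F a b = h * h * Fyx \<xi>' \<eta>'"
    using mixed_difference_mvt[of "\<lambda>v u. F u v" "\<lambda>v u. Fy u v" "\<lambda>v u. Fyx u v", OF 2 21 \<open>h > 0\<close>]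
    by blast
  have "Fxy \<xi> \<eta> = Fyx \<xi>' \<eta>'"
    using x(5) y(5) \<open>h > 0\<close> by (simp add: algebra_simps)
  moreover have "dist (Fxy \<xi> \<eta>) (Fxy a b) < e" "dist (Fyx \<xi>' \<eta>') (Fyx a b) < e"
    using d1(2)[of "(\<xi>, \<eta>)"] d2(2)[of "(\<xi>', \<eta>')"] near x y by auto
  ultimately show False
    by (auto simp: e_def dist_real_def abs_if split: if_splits)
qed

lemma continuous_on_fun_upd:
  fixes x :: "'a::topological_space \<Rightarrow> 'b \<Rightarrow> 'c::topological_space"
  assumes "continuous_on S x" "continuous_on S t"
  shows "continuous_on S (\<lambda>p. (x p)(i := t p))"
proof (rule continuous_on_coordinatewise_then_product)
  fix j
  show "continuous_on S (\<lambda>p. ((x p)(i := t p)) j)"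
    using assms by (cases "j = i") (auto intro: continuous_on_product_then_coordinatewise)
qed

text \<open>All coordinates except i and j are frozen. The resulting coordinate plane lies entirely
  in \<open>Rn n\<close>, so the two-variable statement applies with u and v ranging over all
  reals.\<close>

lemma partial_deriv_commute:
  assumes f: "smooth n f" and "i < n" "j < n" "x \<in> Rn n"
  shows "partial_deriv i (partial_deriv j f) x = partial_deriv j (partial_deriv i f) x"
proof (cases "i = j")
  case False
  let ?x = "\<lambda>u v. x(i := u, j := v)"
  have in_Rn: "?x u v \<in> Rn n" for u v
    using assms by (simp add: fun_upd_in_Rn)
  have along_i: "((\<lambda>u. g (?x u v)) has_real_derivative partial_deriv i g (?x u v)) (at u)"
    if "smooth n g" for g u v
    using smooth_has_partial_deriv[OF that \<open>i < n\<close> in_Rn, of u v u] False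
    by (simp add: fun_upd_twist)
  have along_j: "((\<lambda>v. g (?x u v)) has_real_derivative partial_deriv j g (?x u v)) (at v)"
    if "smooth n g" for g u v
    using smooth_has_partial_deriv[OF that \<open>j < n\<close> in_Rn, of u v v] by simp
  have cont: "continuous_on UNIV (\<lambda>(u, v). g (?x u v))" if "smooth n g" for g
  proof -
    have "continuous_on UNIV (\<lambda>p. x(i := fst p, j := snd p))"
      by (intro continuous_on_fun_upd continuous_intros)
    then show ?thesis
      using continuous_on_compose2[OF smooth_imp_continuous_on[OF that]] in_Rn
      by (fastforce simp: case_prod_beta)
  qed
  have "partial_deriv j (partial_deriv i f) (?x (x i) (x j))
      = partial_deriv i (partial_deriv j f) (?x (x i) (x j))"
    using f smooth_partial_deriv[OF f \<open>i < n\<close>] smooth_partial_deriv[OF f \<open>j < n\<close>]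
    by (intro schwarz_symmetry[OF along_i[of f] along_j[of f] along_j[of "partial_deriv i f"]
          along_i[of "partial_deriv j f"] cont[of "partial_deriv j (partial_deriv i f)"]
          cont[of "partial_deriv i (partial_deriv j f)"]] smooth_partial_deriv assms(2,3))
  then show ?thesis by simp
qed simp

text \<open>Induction on the number of coordinates of the curve that are allowed to move.\<close>

lemma smooth_chain_rule:
  assumes f: "smooth n f" and I: "open I" "t \<in> I" and \<gamma>: "\<And>s. s \<in> I \<Longrightarrow> \<gamma> s \<in> Rn n"
    and \<gamma>': "\<And>i. i < n \<Longrightarrow> ((\<lambda>s. \<gamma> s i) has_real_derivative d i) (at t)"
    and cont: "continuous_on I \<gamma>"
  shows "((\<lambda>s. f (\<gamma> s)) has_real_derivative (\<Sum>j<n. d j * partial_deriv j f (\<gamma> t))) (at t)"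
proof -
  \<comment> \<open>Coordinates below m follow the curve and the others stay at their values at time
    t. Thus \<open>g 0\<close> is constant, and \<open>g n\<close> is the curve itself.\<close>
  define g where "g m s = (\<lambda>i. if i < m then \<gamma> s i else \<gamma> t i)" for m s
  have g_in: "g m s \<in> Rn n" if "s \<in> I" for m s
    using \<gamma>[OF that] \<gamma>[OF I(2)] by (auto simp: g_def topspace_Euclidean_space)
  have g_cont: "continuous_on I (g m)" for m
  proof (rule continuous_on_coordinatewise_then_product)
    show "continuous_on I (\<lambda>s. g m s i)" for i
      using continuous_on_product_then_coordinatewise[OF cont]
      by (cases "i < m") (simp_all add: g_def)
  qed
  have "((\<lambda>s. f (g m s)) has_real_derivative (\<Sum>j<m. d j * partial_deriv j f (\<gamma> t))) (at t)"
    if "m \<le> n" for m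
    using that
  proof (induction m)
    case 0
    then show ?case by (simp add: g_def)
  next
    case (Suc m)
    let ?F = "\<lambda>s y. f ((g m s)(m := y))"
    let ?D = "\<Sum>j<m. d j * partial_deriv j f (\<gamma> t)"
    have [simp]: "(g m t)(m := \<gamma> t m) = \<gamma> t" "g m t = \<gamma> t" "at t within I = at t"
      "(g m s)(m := \<gamma> t m) = g m s" for s
      using at_within_open[OF I(2,1)] by (auto simp: g_def fun_eq_iff)
    \<comment> \<open>The hybrid function is known to be differentiable in s only at t (the
      induction hypothesis), but in y everywhere and with continuous derivative. This asymmetric
      information is enough for joint differentiability at the point.\<close>
    have "((\<lambda>(s, y). ?F s y) has_derivative
        (\<lambda>(ds, dy). ?D * ds + blinfun_mult_right
           (partial_deriv m f ((g m t)(m := \<gamma> t m))) dy)) (at (t, \<gamma> t m) within I \<times> UNIV)"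
    proof (rule has_derivative_partialsI)
      show "((\<lambda>s. ?F s (\<gamma> t m)) has_derivative (*) ?D) (at t within I)"
        using Suc by (simp add: has_field_derivative_def)
      show "((\<lambda>y. ?F s y) has_derivative
          blinfun_apply (blinfun_mult_right (partial_deriv m f ((g m s)(m := y))))) (at y within UNIV)"
        if "s \<in> I" for s y
        using smooth_has_partial_deriv[OF f _ g_in[OF that], of m m y] Suc.prems
        by (simp add: has_field_derivative_def)
      have "continuous_on (I \<times> UNIV) (\<lambda>p. (g m (fst p))(m := snd p))"
        by (intro continuous_on_fun_upd continuous_intros continuous_on_compose2[OF g_cont]) auto
      then have "continuous_on (I \<times> UNIV) (\<lambda>p. partial_deriv m f ((g m (fst p))(m := snd p)))"
        using Suc.prems g_in
        by (intro continuous_on_compose2[OF smooth_imp_continuous_on[OF smooth_partial_deriv[OF f, of m]]])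
           (auto intro!: fun_upd_in_Rn)
      then show "continuous (at (t, \<gamma> t m) within I \<times> UNIV)
          (\<lambda>(s, y). blinfun_mult_right (partial_deriv m f ((g m s)(m := y))))"
        using I unfolding case_prod_beta continuous_on_eq_continuous_within
        by (intro bounded_linear.continuous[OF bounded_linear_blinfun_mult_right]) auto
    qed auto
    then have F: "((\<lambda>(s, y). ?F s y) has_derivative
        (\<lambda>(ds, dy). ?D * ds + partial_deriv m f (\<gamma> t) * dy)) (at (t, \<gamma> t m))"
      using at_within_open[of "(t, \<gamma> t m)" "I \<times> UNIV"] I by (simp add: open_Times)
    \<comment> \<open>Composing with this curve releases coordinate m and turns \<open>g m\<close>
      into \<open>g (Suc m)\<close>.\<close>
    have "((\<lambda>s. (s, \<gamma> s m)) has_derivative (\<lambda>h. (h, d m * h))) (at t)"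
      using \<gamma>'[of m] Suc.prems
      by (auto intro!: derivative_eq_intros simp: has_field_derivative_def)
    from has_derivative_compose[OF this F]
    have "((\<lambda>s. f ((g m s)(m := \<gamma> s m))) has_derivative
        (\<lambda>h. ?D * h + partial_deriv m f (\<gamma> t) * (d m * h))) (at t)"
      by simp
    moreover have "(g m s)(m := \<gamma> s m) = g (Suc m) s" for s
      by (auto simp: g_def fun_eq_iff less_Suc_eq)
    moreover have "(\<lambda>h. ?D * h + partial_deriv m f (\<gamma> t) * (d m * h))
        = (*) (\<Sum>j<Suc m. d j * partial_deriv j f (\<gamma> t))"
      by (simp add: fun_eq_iff algebra_simps)
    ultimately show ?case
      by (simp only: has_field_derivative_def)
  qed
  from this[of n] have "((\<lambda>s. f (g n s)) has_real_derivative
      (\<Sum>j<n. d j * partial_deriv j f (\<gamma> t))) (at t)" by simp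
  then show ?thesis
  proof (rule has_field_derivative_transform_within_open[OF _ I])
    show "f (g n s) = f (\<gamma> s)" if "s \<in> I" for s
    proof -
      \<comment> \<open>Coordinates from n on are frozen in \<open>g n\<close>, but they are 0 at
        every point of \<open>Rn n\<close>.\<close>
      have "g n s = \<gamma> s"
        using \<gamma>[OF that] \<gamma>[OF I(2)] by (auto simp: g_def fun_eq_iff topspace_Euclidean_space)
      then show ?thesis by simp
    qed
  qed
qed

section \<open>Uniqueness of the Levi-Civita connection\<close>

lemma vector_field_in_tangent_space: "X \<in> vector_fields M \<Longrightarrow> X p \<in> tangent_space M p"
  by (simp add: vector_fields_def)

lemma tangent_space_diff:
  assumes "u \<in> tangent_space M p" "v \<in> tangent_space M p"
  shows "u - v \<in> tangent_space M p"
  unfolding tangent_space_def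
proof (intro CollectI conjI ballI allI impI)
  fix c d i
  assume "c \<in> charts_at M p" "d \<in> charts_at M p" "i < mdim M"
  then have "u d i = (\<Sum>j<mdim M. transition_jacobian c d p i j * u c j)"
    "v d i = (\<Sum>j<mdim M. transition_jacobian c d p i j * v c j)"
    using assms unfolding tangent_space_def by blast+
  then show "(u - v) d i = (\<Sum>j<mdim M. transition_jacobian c d p i j * (u - v) c j)"
    by (simp only: minus_apply right_diff_distrib sum_subtractf)
qed (use assms in \<open>auto simp: tangent_space_def topspace_Euclidean_space\<close>)

lemma riemannian_metric:
  assumes "riemannian_manifold M" "p \<in> topspace (mtop M)"
    "u \<in> tangent_space M p" "v \<in> tangent_space M p"
  shows "mmetric M p u v = mmetric M p v u"
    and "w \<in> tangent_space M p \<Longrightarrow> mmetric M p (u + v) w = mmetric M p u w + mmetric M p v w"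
    and "u \<noteq> 0 \<Longrightarrow> mmetric M p u u > 0"
  using assms by (auto simp: riemannian_manifold_def)

lemma levi_civita_metric:
  assumes "is_levi_civita M nab" "X \<in> vector_fields M" "Y \<in> vector_fields M"
    "Z \<in> vector_fields M" "p \<in> topspace (mtop M)"
  shows "mmetric M p (nab X Y p) (Z p) + mmetric M p (Y p) (nab X Z p)
    = dir_deriv M p (X p) (\<lambda>q. mmetric M q (Y q) (Z q))"
  using assms by (simp add: is_levi_civita_def)

text \<open>The difference \<open>T\<close> of the two connections, as a trilinear form, is symmetric in the first
  two arguments and skew in the last two, hence zero.\<close>

lemma levi_civita_unique:
  assumes M: "riemannian_manifold M" and nab: "is_levi_civita M nab" "is_levi_civita M nab'"
    and X: "X \<in> vector_fields M" and Y: "Y \<in> vector_fields M"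
  shows "nab X Y = nab' X Y"
proof
  fix p
  have closed: "nab V W \<in> vector_fields M" "nab' V W \<in> vector_fields M"
    if "V \<in> vector_fields M" "W \<in> vector_fields M" for V W
    using nab that by (auto simp: is_levi_civita_def affine_connection_def)
  note tan = closed[THEN vector_field_in_tangent_space] vector_field_in_tangent_space
  show "nab X Y p = nab' X Y p"
  proof (cases "p \<in> topspace (mtop M)")
    case True
    note g = riemannian_metric[OF M True]
    define T where "T U V W = mmetric M p (nab U V p) (W p) - mmetric M p (nab' U V p) (W p)"
      for U V W
    have sym: "T U V W = T V U W"
      if "U \<in> vector_fields M" "V \<in> vector_fields M" "W \<in> vector_fields M" for U V W
    proof -
      have "nab U V - nab V U = nab' U V - nab' V U"
        using nab that by (simp add: is_levi_civita_def)
      then have "nab U V p - nab V U p = nab' U V p - nab' V U p"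
        by (auto dest: fun_cong[of _ _ p] simp only: minus_apply)
      \<comment> \<open>The torsion identity is rearranged into an equation between sums because the
        metric axioms supply additivity, not a rule for differences.\<close>
      then have "nab U V p + nab' V U p = nab' U V p + nab V U p"
        by (simp add: algebra_simps)
      then have "mmetric M p (nab U V p + nab' V U p) (W p) = mmetric M p (nab' U V p + nab V U p) (W p)"
        by simp
      then show ?thesis
        using that by (simp add: g(2) tan T_def)
    qed
    have skew: "T U V W = - T U W V"
      if "U \<in> vector_fields M" "V \<in> vector_fields M" "W \<in> vector_fields M" for U V W
    proof -
      have "mmetric M p (nab U V p) (W p) + mmetric M p (V p) (nab U W p)
          = mmetric M p (nab' U V p) (W p) + mmetric M p (V p) (nab' U W p)"
        using nab that True by (simp only: levi_civita_metric)
      then show ?thesis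
        using that by (simp add: g(1)[of "V p"] tan T_def)
    qed
    have T0: "T X Y Z = 0" if "Z \<in> vector_fields M" for Z
    proof -
      \<comment> \<open>A skew swap followed by a symmetric swap is a cyclic shift with a sign.
        Three shifts return to the start with total sign -1.\<close>
      have "T X Y Z = - T Z X Y" "T Z X Y = - T Y Z X" "T Y Z X = - T X Y Z"
        using skew[of X Y Z] skew[of Z X Y] skew[of Y Z X]
          sym[of X Z Y] sym[of Z Y X] sym[of Y X Z] X Y that by auto
      then show ?thesis by simp
    qed
    define u v where "u = nab X Y p" and "v = nab' X Y p"
    have uv: "u \<in> tangent_space M p" "v \<in> tangent_space M p" "u - v \<in> tangent_space M p"
      using X Y by (simp_all add: u_def v_def tan tangent_space_diff)
    have "mmetric M p u w = mmetric M p (u - v) w + mmetric M p v w"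
      if "w \<in> tangent_space M p" for w
      using g(2)[OF uv(3,2) that] by simp
    \<comment> \<open>The test fields are the two covariant derivatives themselves. They are already
      global vector fields, so no tangent vector has to be extended by a bump function.\<close>
    moreover have "mmetric M p u u = mmetric M p v u" "mmetric M p u v = mmetric M p v v"
      using T0[OF closed(1)[OF X Y]] T0[OF closed(2)[OF X Y]] by (simp_all add: T_def u_def v_def)
    ultimately have "mmetric M p (u - v) (u - v) = 0"
      using uv g(1)[OF uv(1) uv(3)] g(1)[OF uv(2) uv(3)] by fastforce
    then show ?thesis
      using g(3)[OF uv(3) uv(3)] by (auto simp: u_def v_def)
  next
    \<comment> \<open>The claim is an equality of total functions, so points off the manifold count
      too; no chart contains them and their tangent space is zero.\<close>
    case False
    have "v = 0" if "smooth_manifold M" "v \<in> tangent_space M p" for v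
    proof -
      have "charts_at M p = {}"
        using that False by (auto simp: charts_at_def smooth_manifold_def)
      with that show ?thesis by (auto simp: tangent_space_def fun_eq_iff)
    qed
    moreover have "smooth_manifold M"
      using M by (simp add: riemannian_manifold_def)
    ultimately have "nab X Y p = 0" "nab' X Y p = 0"
      using tan(1)[OF X Y] tan(2)[OF X Y] by blast+
    then show ?thesis by simp
  qed
qed


section \<open>Flat space\<close>

definition std_chart :: "nat \<Rightarrow> (nat \<Rightarrow> real) chart" where
  "std_chart n = (Rn n, \<lambda>x. x)"

definition flat_space :: "nat \<Rightarrow> riem" where
  "flat_space n = \<lparr>mtop = Euclidean_space n, mdim = n, matlas = {std_chart n},
     mmetric = (\<lambda>p u v. \<Sum>i<n. u (std_chart n) i * v (std_chart n) i)\<rparr>"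

lemma flat_space_sel [simp]:
  "mtop (flat_space n) = Euclidean_space n" "mdim (flat_space n) = n"
  "matlas (flat_space n) = {std_chart n}"
  "mmetric (flat_space n) p u v = (\<Sum>i<n. u (std_chart n) i * v (std_chart n) i)"
  by (simp_all add: flat_space_def)

lemma std_chart_sel [simp]: "fst (std_chart n) = Rn n" "snd (std_chart n) = (\<lambda>x. x)"
  by (simp_all add: std_chart_def)

lemma chart_inv_std_chart [simp]: "x \<in> Rn n \<Longrightarrow> chart_inv (std_chart n) x = x"
  by (simp add: chart_inv_def inv_into_f_eq)

lemma charts_at_flat_space [simp]:
  "charts_at (flat_space n) p = (if p \<in> Rn n then {std_chart n} else {})"
  by (auto simp: charts_at_def)

lemma chart_at_flat_space [simp]: "p \<in> Rn n \<Longrightarrow> chart_at (flat_space n) p = std_chart n"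
  by (simp add: chart_at_def)

text \<open>\<open>chart_inv\<close> is the identity only on \<open>Rn n\<close> and unspecified
  elsewhere, but a coordinate line in a direction below n never leaves \<open>Rn n\<close>.\<close>

lemma partial_deriv_chart_inv:
  "p \<in> Rn n \<Longrightarrow> i < n \<Longrightarrow>
    partial_deriv i (\<lambda>x. f (chart_inv (std_chart n) x)) p = partial_deriv i f p"
  by (rule partial_deriv_cong[of n]) auto

lemma smooth_chart_inv: "smooth n (\<lambda>x. f (chart_inv (std_chart n) x)) \<longleftrightarrow> smooth n f"
  by (rule smooth_cong) auto

lemma transition_jacobian_std_chart [simp]:
  "p \<in> Rn n \<Longrightarrow> j < n \<Longrightarrow>
    transition_jacobian (std_chart n) (std_chart n) p i j = (if i = j then 1 else 0)"
  using partial_deriv_chart_inv[of p n j "\<lambda>x. x i"]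
  by (auto simp: transition_jacobian_def partial_deriv_coord)

section \<open>Tangent vectors and vector fields in components\<close>

definition flat_vec :: "nat \<Rightarrow> (nat \<Rightarrow> real) \<Rightarrow> (nat \<Rightarrow> real) tvec" where
  "flat_vec n u = (\<lambda>c i. if c = std_chart n \<and> i < n then u i else 0)"

text \<open>The zero values off \<open>Rn n\<close>, in other charts and at indices from n on are
  exactly those that \<open>tangent_space\<close> imposes. Hence every vector field has this form
  and equality of fields reduces to their components.\<close>

definition flat_field :: "nat \<Rightarrow> (nat \<Rightarrow> (nat \<Rightarrow> real) \<Rightarrow> real) \<Rightarrow> (nat \<Rightarrow> real) vfield" where
  "flat_field n F = (\<lambda>p. if p \<in> Rn n then flat_vec n (\<lambda>i. F i p) else 0)"

lemma flat_vec_component [simp]: "i < n \<Longrightarrow> flat_vec n u (std_chart n) i = u i"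
  by (simp add: flat_vec_def)

lemma flat_vec_cong: "(\<And>i. i < n \<Longrightarrow> u i = v i) \<Longrightarrow> flat_vec n u = flat_vec n v"
  by (auto simp: flat_vec_def fun_eq_iff)

lemma flat_vec_eq_iff: "flat_vec n u = flat_vec n v \<longleftrightarrow> (\<forall>i<n. u i = v i)"
  by (metis flat_vec_component flat_vec_cong)

lemma flat_vec_zero [simp]: "flat_vec n (\<lambda>i. 0) = 0"
  by (simp add: flat_vec_def fun_eq_iff)

lemma flat_vec_eq_0_iff: "flat_vec n u = 0 \<longleftrightarrow> (\<forall>i<n. u i = 0)"
  using flat_vec_eq_iff[of n u "\<lambda>i. 0"] by simp

lemma flat_field_at [simp]: "p \<in> Rn n \<Longrightarrow> flat_field n F p = flat_vec n (\<lambda>i. F i p)"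
  by (simp add: flat_field_def)

lemma flat_field_cong:
  "(\<And>i p. i < n \<Longrightarrow> p \<in> Rn n \<Longrightarrow> F i p = G i p) \<Longrightarrow> flat_field n F = flat_field n G"
  unfolding flat_field_def by (intro ext) (simp cong: flat_vec_cong)

lemma flat_vec_arith:
  "flat_vec n u + flat_vec n v = flat_vec n (\<lambda>i. u i + v i)"
  "flat_vec n u - flat_vec n v = flat_vec n (\<lambda>i. u i - v i)"
  "a *\<^sub>T flat_vec n u = flat_vec n (\<lambda>i. a * u i)"
  by (auto simp: flat_vec_def tscale_def fun_eq_iff)

lemma tscale_apply: "(a *\<^sub>T v) c i = a * v c i"
  by (simp add: tscale_def)

lemma tscale_zero [simp]: "a *\<^sub>T 0 = 0"
  by (simp add: tscale_def fun_eq_iff)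

lemma flat_field_arith:
  "flat_field n F + flat_field n G = flat_field n (\<lambda>i p. F i p + G i p)"
  "flat_field n F - flat_field n G = flat_field n (\<lambda>i p. F i p - G i p)"
  "(\<lambda>p. f p *\<^sub>T flat_field n F p) = flat_field n (\<lambda>i p. f p * F i p)"
  by (rule ext, simp add: flat_field_def flat_vec_arith)+

lemma tangent_space_flat_space:
  "tangent_space (flat_space n) p = (if p \<in> Rn n then range (flat_vec n) else {0})"
proof (cases "p \<in> Rn n")
  case True
  have "v = flat_vec n (v (std_chart n))" if "v \<in> tangent_space (flat_space n) p" for v
  proof (intro ext)
    show "v c i = flat_vec n (v (std_chart n)) c i" for c i
      using that True
      by (cases "c = std_chart n")
         (auto simp: tangent_space_def flat_vec_def topspace_Euclidean_space
          simp del: split_paired_All)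
  qed
  moreover have "flat_vec n u \<in> tangent_space (flat_space n) p" for u
  proof -
    have "(\<Sum>j<n. transition_jacobian (std_chart n) (std_chart n) p i j * u j) = u i" if "i < n" for i
    proof -
      have "(\<Sum>j<n. transition_jacobian (std_chart n) (std_chart n) p i j * u j)
          = (\<Sum>j<n. if i = j then u j else 0)"
        by (rule sum.cong) (use True in auto)
      then show ?thesis using that by simp
    qed
    then show ?thesis
      using True by (auto simp: tangent_space_def flat_vec_def fun_eq_iff topspace_Euclidean_space)
  qed
  ultimately show ?thesis using True by auto
qed (auto simp: tangent_space_def fun_eq_iff)

lemma flat_field_in_vector_fields:
  assumes "\<And>i. i < n \<Longrightarrow> smooth n (F i)"
  shows "flat_field n F \<in> vector_fields (flat_space n)"
proof -
  have "smooth n (\<lambda>x. flat_field n F (chart_inv (std_chart n) x) (std_chart n) i)" if "i < n" for i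
    using assms[OF that] that
    by (subst smooth_cong[where g = "F i"]) auto
  then show ?thesis
    by (auto simp: vector_fields_def tangent_space_flat_space flat_field_def)
qed

lemma vector_fields_flat_spaceE:
  assumes "X \<in> vector_fields (flat_space n)"
  obtains F where "X = flat_field n F" "\<And>i. i < n \<Longrightarrow> smooth n (F i)"
proof
  have tan: "X p \<in> tangent_space (flat_space n) p" for p
    using assms by (rule vector_field_in_tangent_space)
  show "X = flat_field n (\<lambda>i p. X p (std_chart n) i)"
  proof
    show "X p = flat_field n (\<lambda>i p. X p (std_chart n) i) p" for p
      using tan[of p]
      by (auto simp: tangent_space_flat_space flat_field_def flat_vec_eq_iff split: if_splits)
  qed
  show "smooth n (\<lambda>p. X p (std_chart n) i)" if "i < n" for i
    using assms that smooth_chart_inv[of n "\<lambda>p. X p (std_chart n) i"]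
    by (simp add: vector_fields_def)
qed

lemma coord_vec_flat_space:
  "p \<in> Rn n \<Longrightarrow> j < n \<Longrightarrow>
    coord_vec (flat_space n) (std_chart n) j p = flat_vec n (\<lambda>i. if i = j then 1 else 0)"
  by (auto simp: coord_vec_def flat_vec_def fun_eq_iff)

section \<open>Flat space as a noncompact Riemannian manifold\<close>

lemma second_countable_Euclidean_space: "second_countable (Euclidean_space n)"
proof -
  obtain \<B> :: "(nat \<Rightarrow> real) set set" where "countable \<B>" "\<And>C. C \<in> \<B> \<Longrightarrow> open C"
    "\<And>S. open S \<Longrightarrow> \<exists>U. U \<subseteq> \<B> \<and> S = \<Union>U"
    using univ_second_countable by blast
  then have "second_countable (euclidean :: (nat \<Rightarrow> real) topology)"
    unfolding second_countable_def open_openin[symmetric]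
    by (intro exI[of _ \<B>]) (metis Union_iff Union_upper in_mono)
  then show ?thesis
    by (simp add: Euclidean_space_def euclidean_product_topology second_countable_subtopology)
qed

text \<open>The first coordinate is continuous and, for positive n, maps onto the whole real line,
  which is not compact.\<close>

lemma not_compact_space_Euclidean_space:
  assumes "n > 0"
  shows "\<not> compact_space (Euclidean_space n)"
proof
  assume "compact_space (Euclidean_space n)"
  moreover have "continuous_map (Euclidean_space n) euclideanreal (\<lambda>x. x 0)"
    by (simp add: continuous_map_Euclidean_space_iff
        continuous_on_subset[OF continuous_on_product_coordinates])
  ultimately have "compact ((\<lambda>x. x 0) ` Rn n)"
    using image_compactin[of "Euclidean_space n" "Rn n" euclideanreal "\<lambda>x. x 0"]
    by (simp add: compact_space_def)
  moreover have "(\<lambda>x. x 0) ` Rn n = (UNIV :: real set)"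
  proof -
    have "t \<in> (\<lambda>x. x 0) ` Rn n" for t :: real
      using assms by (intro image_eqI[of _ _ "(\<lambda>i. 0)(0 := t)"]) (auto simp: topspace_Euclidean_space)
    then show ?thesis by blast
  qed
  ultimately show False
    using not_compact_UNIV[where 'a = real] by simp
qed

lemma smooth_manifold_flat_space: "smooth_manifold (flat_space n)"
proof -
  have "Hausdorff_space (Euclidean_space n)"
    by (simp add: Euclidean_space_def euclidean_product_topology Hausdorff_space_subtopology)
  moreover have "is_chart (Euclidean_space n) n (std_chart n)"
    using homeomorphic_map_id[of "Euclidean_space n" "Euclidean_space n"]
    by (simp add: is_chart_def id_def)
  moreover have "smooth n (\<lambda>x. chart_inv (std_chart n) x i)" for i
    using smooth_chart_inv[of n "\<lambda>x. x i"] by simp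
  ultimately show ?thesis
    by (simp add: smooth_manifold_def second_countable_Euclidean_space)
qed

lemma riemannian_manifold_flat_space: "riemannian_manifold (flat_space n)"
proof -
  have "smooth n (\<lambda>x. \<Sum>k<n. coord_vec (flat_space n) (std_chart n) i (chart_inv (std_chart n) x) (std_chart n) k *
                     coord_vec (flat_space n) (std_chart n) j (chart_inv (std_chart n) x) (std_chart n) k)"
    if "i < n" "j < n" for i j
    using that
    by (subst smooth_cong[where g = "\<lambda>x. \<Sum>k<n. (if k = i then 1 else 0) * (if k = j then 1 else 0)"])
       (auto simp: coord_vec_flat_space intro!: sum.cong)
  moreover have "(\<Sum>i<n. u (std_chart n) i * u (std_chart n) i) > 0"
    if "p \<in> Rn n" "u \<in> tangent_space (flat_space n) p" "u \<noteq> 0" for p u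
  proof -
    have "u \<in> range (flat_vec n)"
      using that by (simp add: tangent_space_flat_space)
    then obtain w where u: "u = flat_vec n w"
      by blast
    with that obtain k where "k < n" "w k \<noteq> 0" by (auto simp: flat_vec_eq_0_iff)
    then have "(\<Sum>i<n. w i * w i) > 0"
      by (intro sum_pos2[of _ k]) (auto simp: zero_less_mult_iff)
    then show ?thesis by (simp add: u)
  qed
  ultimately show ?thesis
    by (auto simp: riemannian_manifold_def smooth_manifold_flat_space tscale_def
        sum_distrib_left sum.distrib[symmetric] algebra_simps intro!: sum.cong)
qed


section \<open>The flat connection\<close>

definition deriv_in_direction ::
    "nat \<Rightarrow> (nat \<Rightarrow> (nat \<Rightarrow> real) \<Rightarrow> real) \<Rightarrow> ((nat \<Rightarrow> real) \<Rightarrow> real) \<Rightarrow> (nat \<Rightarrow> real) \<Rightarrow> real" where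
  "deriv_in_direction n F f p = (\<Sum>j<n. F j p * partial_deriv j f p)"

definition flat_nabla :: "nat \<Rightarrow> (nat \<Rightarrow> real) vfield \<Rightarrow> (nat \<Rightarrow> real) vfield \<Rightarrow> (nat \<Rightarrow> real) vfield" where
  "flat_nabla n X Y = flat_field n
     (\<lambda>i. deriv_in_direction n (\<lambda>j p. X p (std_chart n) j) (\<lambda>p. Y p (std_chart n) i))"

lemma smooth_deriv_in_direction:
  assumes "\<And>i. i < n \<Longrightarrow> smooth n (F i)" "smooth n f"
  shows "smooth n (deriv_in_direction n F f)"
  unfolding deriv_in_direction_def
  using assms by (intro smooth_sum smooth_mult smooth_partial_deriv) auto

lemma deriv_in_direction_cong:
  assumes "\<And>j. j < n \<Longrightarrow> F j p = G j p" "\<And>q. q \<in> Rn n \<Longrightarrow> f q = g q" "p \<in> Rn n"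
  shows "deriv_in_direction n F f p = deriv_in_direction n G g p"
  unfolding deriv_in_direction_def
  using assms partial_deriv_cong[of n f g p] by (intro sum.cong) auto

lemma deriv_in_direction_add:
  assumes "smooth n f" "smooth n g" "p \<in> Rn n"
  shows "deriv_in_direction n F (\<lambda>x. f x + g x) p
    = deriv_in_direction n F f p + deriv_in_direction n F g p"
  using assms
  by (simp add: deriv_in_direction_def partial_deriv_add[where n = n] algebra_simps sum.distrib)

lemma deriv_in_direction_mult:
  assumes "smooth n f" "smooth n g" "p \<in> Rn n"
  shows "deriv_in_direction n F (\<lambda>x. f x * g x) p
    = f p * deriv_in_direction n F g p + deriv_in_direction n F f p * g p"
  using assms
  by (simp add: deriv_in_direction_def partial_deriv_mult[where n = n] algebra_simps
      sum.distrib sum_distrib_left)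

lemma deriv_in_direction_sum:
  assumes "\<And>j. j \<in> A \<Longrightarrow> smooth n (f j)" "p \<in> Rn n"
  shows "deriv_in_direction n F (\<lambda>x. \<Sum>j\<in>A. f j x) p = (\<Sum>j\<in>A. deriv_in_direction n F (f j) p)"
  using assms
proof (induction A rule: infinite_finite_induct)
  case (insert a A)
  then show ?case by (simp add: deriv_in_direction_add smooth_sum)
qed (simp_all add: deriv_in_direction_def partial_deriv_def)

lemma flat_nabla_flat_field:
  "flat_nabla n (flat_field n F) (flat_field n G)
    = flat_field n (\<lambda>i. deriv_in_direction n F (G i))"
  unfolding flat_nabla_def by (intro flat_field_cong deriv_in_direction_cong) auto

lemma lie_bracket_flat_field:
  "lie_bracket (flat_space n) (flat_field n F) (flat_field n G)
    = flat_field n (\<lambda>i p. deriv_in_direction n F (G i) p - deriv_in_direction n G (F i) p)"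
proof (intro ext)
  fix p c i
  have *: "partial_deriv j (\<lambda>x. flat_field n H (chart_inv (std_chart n) x) (std_chart n) i) p
      = partial_deriv j (H i) p" if "p \<in> Rn n" "i < n" "j < n" for H j
    by (rule partial_deriv_cong[of n]) (use that in auto)
  show "lie_bracket (flat_space n) (flat_field n F) (flat_field n G) p c i
    = flat_field n (\<lambda>i p. deriv_in_direction n F (G i) p - deriv_in_direction n G (F i) p) p c i"
    by (auto simp: lie_bracket_def flat_field_def[of n "\<lambda>i p. _ i p - _ i p"] flat_vec_def[of n "\<lambda>i. _ i - _ i"]
      deriv_in_direction_def * sum_subtractf)
qed

lemma smooth_fun_flat_space: "smooth_fun (flat_space n) f \<longleftrightarrow> smooth n f"
  by (simp add: smooth_fun_def smooth_chart_inv)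

lemma dir_deriv_flat_space:
  "p \<in> Rn n \<Longrightarrow> dir_deriv (flat_space n) p (flat_field n F p) f = deriv_in_direction n F f p"
  by (simp add: dir_deriv_def deriv_in_direction_def partial_deriv_chart_inv)

text \<open>In components, vanishing torsion is the coordinate formula of the Lie bracket, and
  metric compatibility is the product rule because the metric coefficients are constant.\<close>

lemma is_levi_civita_flat_nabla: "is_levi_civita (flat_space n) (flat_nabla n)"
  unfolding is_levi_civita_def affine_connection_def
proof (intro conjI ballI allI impI)
  fix X Y
  assume "X \<in> vector_fields (flat_space n)" "Y \<in> vector_fields (flat_space n)"
  then obtain F G where F: "X = flat_field n F" "\<And>i. i < n \<Longrightarrow> smooth n (F i)"
    and G: "Y = flat_field n G" "\<And>i. i < n \<Longrightarrow> smooth n (G i)"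
    by (metis vector_fields_flat_spaceE)
  show "flat_nabla n X Y \<in> vector_fields (flat_space n)"
    using F G by (simp add: flat_nabla_flat_field flat_field_in_vector_fields smooth_deriv_in_direction)
  show "flat_nabla n X Y - flat_nabla n Y X = lie_bracket (flat_space n) X Y"
    by (simp add: F G flat_nabla_flat_field lie_bracket_flat_field flat_field_arith)
  {
    fix Z
    assume "Z \<in> vector_fields (flat_space n)"
    then obtain H where H: "Z = flat_field n H" "\<And>i. i < n \<Longrightarrow> smooth n (H i)"
      by (metis vector_fields_flat_spaceE)
    show "flat_nabla n (X + Y) Z = flat_nabla n X Z + flat_nabla n Y Z"
      unfolding F G H flat_nabla_flat_field flat_field_arith
      by (intro flat_field_cong) (simp add: deriv_in_direction_def algebra_simps sum.distrib)
    show "flat_nabla n Z (X + Y) = flat_nabla n Z X + flat_nabla n Z Y"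
      unfolding F G H flat_nabla_flat_field flat_field_arith
      by (intro flat_field_cong) (use F G in \<open>simp add: deriv_in_direction_add\<close>)
    fix p assume "p \<in> topspace (mtop (flat_space n))"
    then have p: "p \<in> Rn n" by simp
    have "dir_deriv (flat_space n) p (X p) (\<lambda>q. mmetric (flat_space n) q (Y q) (Z q))
        = deriv_in_direction n F (\<lambda>q. \<Sum>i<n. G i q * H i q) p"
      unfolding F(1) dir_deriv_flat_space[OF p]
      by (rule deriv_in_direction_cong) (use p G H in auto)
    also have "\<dots> = (\<Sum>i<n. deriv_in_direction n F (G i) p * H i p + G i p * deriv_in_direction n F (H i) p)"
      using G H p
      by (subst deriv_in_direction_sum)
         (auto simp: deriv_in_direction_mult algebra_simps intro: smooth_mult)
    finally show "dir_deriv (flat_space n) p (X p) (\<lambda>q. mmetric (flat_space n) q (Y q) (Z q)) =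
        mmetric (flat_space n) p (flat_nabla n X Y p) (Z p) +
        mmetric (flat_space n) p (Y p) (flat_nabla n X Z p)"
      using p by (simp add: F G H flat_nabla_flat_field sum.distrib)
  }
  fix f assume "smooth_fun (flat_space n) f"
  then have f: "smooth n f" by (simp add: smooth_fun_flat_space)
  show "flat_nabla n (\<lambda>p. f p *\<^sub>T X p) Y = (\<lambda>p. f p *\<^sub>T flat_nabla n X Y p)"
    unfolding F G flat_nabla_flat_field flat_field_arith
    by (intro flat_field_cong) (simp add: deriv_in_direction_def sum_distrib_left algebra_simps)
  show "flat_nabla n X (\<lambda>p. f p *\<^sub>T Y p)
      = (\<lambda>p. f p *\<^sub>T flat_nabla n X Y p + dir_deriv (flat_space n) p (X p) f *\<^sub>T Y p)"
  proof
    fix p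
    show "flat_nabla n X (\<lambda>p. f p *\<^sub>T Y p) p
      = f p *\<^sub>T flat_nabla n X Y p + dir_deriv (flat_space n) p (X p) f *\<^sub>T Y p"
    proof (cases "p \<in> Rn n")
      case True
      then show ?thesis
        unfolding F(1) dir_deriv_flat_space[OF True]
        unfolding G(1) flat_nabla_flat_field flat_field_arith
        using f G by (simp add: flat_vec_arith flat_vec_eq_iff deriv_in_direction_mult)
    next
      case False
      then show ?thesis
        unfolding F(1) G(1) flat_nabla_flat_field flat_field_arith by (simp add: flat_field_def)
    qed
  qed
qed

text \<open>The flat connection witnesses that the choice succeeds, and uniqueness identifies the
  chosen connection with it. Smooth components are required because the axioms determine a
  connection only on vector fields.\<close>

lemma levi_civita_flat_space:
  assumes "\<And>i. i < n \<Longrightarrow> smooth n (F i)" "\<And>i. i < n \<Longrightarrow> smooth n (G i)"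
  shows "levi_civita (flat_space n) (flat_field n F) (flat_field n G)
    = flat_field n (\<lambda>i. deriv_in_direction n F (G i))"
proof -
  have "is_levi_civita (flat_space n) (levi_civita (flat_space n))"
    unfolding levi_civita_def by (rule someI[of "is_levi_civita (flat_space n)", OF is_levi_civita_flat_nabla])
  from levi_civita_unique[OF riemannian_manifold_flat_space this is_levi_civita_flat_nabla]
  show ?thesis
    using assms by (simp add: flat_field_in_vector_fields flat_nabla_flat_field)
qed

text \<open>The constant field shows that an extension exists. Of the extension actually chosen,
  only smoothness and the value at p are known.\<close>

lemma extend_tvec_flat_spaceE:
  assumes "p \<in> Rn n"
  obtains F where "extend_tvec (flat_space n) p (flat_vec n u) = flat_field n F"
    "\<And>i. i < n \<Longrightarrow> smooth n (F i)" "\<And>i. i < n \<Longrightarrow> F i p = u i"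
proof -
  let ?V = "extend_tvec (flat_space n) p (flat_vec n u)"
  have "flat_field n (\<lambda>i q. u i) \<in> vector_fields (flat_space n) \<and> flat_field n (\<lambda>i q. u i) p = flat_vec n u"
    using assms by (simp add: flat_field_in_vector_fields)
  then have V: "?V \<in> vector_fields (flat_space n)" "?V p = flat_vec n u"
    unfolding extend_tvec_def by (metis (mono_tags, lifting) someI)+
  from V(1) obtain F where "?V = flat_field n F" "\<And>i. i < n \<Longrightarrow> smooth n (F i)"
    by (rule vector_fields_flat_spaceE) blast
  with V(2) assms show thesis
    by (intro that[of F]) (auto simp: flat_vec_eq_iff)
qed

lemma nabla_at_flat_space:
  assumes "p \<in> Rn n" "\<And>i. i < n \<Longrightarrow> smooth n (G i)"
  shows "nabla_at (flat_space n) p (flat_vec n u) (flat_field n G)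
    = flat_vec n (\<lambda>i. \<Sum>j<n. u j * partial_deriv j (G i) p)"
proof -
  obtain F where "extend_tvec (flat_space n) p (flat_vec n u) = flat_field n F"
    "\<And>i. i < n \<Longrightarrow> smooth n (F i)" "\<And>i. i < n \<Longrightarrow> F i p = u i"
    using extend_tvec_flat_spaceE[OF assms(1)] by metis
  with assms show ?thesis
    by (simp add: nabla_at_def levi_civita_flat_space deriv_in_direction_def)
qed

text \<open>Expanding both iterated derivatives gives second-order terms, which cancel by symmetry
  of mixed partials, and first-order terms, which make up the derivative along the Lie
  bracket.\<close>

lemma deriv_in_direction_commutator:
  assumes "\<And>i. i < n \<Longrightarrow> smooth n (F i)" "\<And>i. i < n \<Longrightarrow> smooth n (G i)" "smooth n h" "p \<in> Rn n"
  shows "deriv_in_direction n F (deriv_in_direction n G h) p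
      - deriv_in_direction n G (deriv_in_direction n F h) p
    = deriv_in_direction n (\<lambda>i p. deriv_in_direction n F (G i) p - deriv_in_direction n G (F i) p) h p"
proof -
  have expand: "deriv_in_direction n A (deriv_in_direction n B h) p
      = (\<Sum>k<n. \<Sum>j<n. A j p * B k p * partial_deriv j (partial_deriv k h) p)
        + (\<Sum>k<n. deriv_in_direction n A (B k) p * partial_deriv k h p)"
    if "\<And>i. i < n \<Longrightarrow> smooth n (B i)" for A B
  proof -
    have "deriv_in_direction n A (deriv_in_direction n B h) p
        = (\<Sum>k<n. B k p * deriv_in_direction n A (partial_deriv k h) p
            + deriv_in_direction n A (B k) p * partial_deriv k h p)"
      unfolding deriv_in_direction_def[of n B]
      using assms that
      by (subst deriv_in_direction_sum)
         (auto simp: deriv_in_direction_mult smooth_partial_deriv intro: smooth_mult)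
    then show ?thesis
      by (simp add: sum.distrib deriv_in_direction_def[of n A "partial_deriv _ h"]
          sum_distrib_left algebra_simps)
  qed
  have "(\<Sum>k<n. \<Sum>j<n. F j p * G k p * partial_deriv j (partial_deriv k h) p)
      = (\<Sum>k<n. \<Sum>j<n. G j p * F k p * partial_deriv j (partial_deriv k h) p)"
    \<comment> \<open>Exchanging the summation indices interchanges the roles of F and G, at the
      price of swapping the two partial derivatives.\<close>
    by (subst sum.swap) (use assms partial_deriv_commute[OF assms(3) _ _ assms(4)] in
        \<open>auto intro!: sum.cong simp: algebra_simps\<close>)
  then show ?thesis
    using assms
    by (simp add: expand deriv_in_direction_def[of n "\<lambda>i p. _ i p - _ i p"] sum_subtractf left_diff_distrib)
qed

text \<open>Each component of the curvature is the commutator identity applied to that component of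
  the third field; this covers arbitrary extensions.\<close>

lemma curvature_at_flat_space:
  assumes "p \<in> Rn n"
  shows "curvature_at (flat_space n) p (flat_vec n u) (flat_vec n v) (flat_vec n w) = 0"
proof -
  obtain F G H where ext:
    "extend_tvec (flat_space n) p (flat_vec n u) = flat_field n F"
    "extend_tvec (flat_space n) p (flat_vec n v) = flat_field n G"
    "extend_tvec (flat_space n) p (flat_vec n w) = flat_field n H"
    and smooth: "\<And>i. i < n \<Longrightarrow> smooth n (F i)" "\<And>i. i < n \<Longrightarrow> smooth n (G i)"
    "\<And>i. i < n \<Longrightarrow> smooth n (H i)"
    using extend_tvec_flat_spaceE[OF assms] by metis
  show ?thesis
    using assms smooth deriv_in_direction_commutator[of n F G "H _" p]
    by (simp add: curvature_at_def curvature_def ext lie_bracket_flat_field levi_civita_flat_space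
        smooth_deriv_in_direction smooth_diff flat_field_arith flat_vec_eq_0_iff)
qed

section \<open>Curves in flat space\<close>

lemma smooth_on_line_imp_differentiable:
  "smooth_on_line J f \<Longrightarrow> t \<in> J \<Longrightarrow> f field_differentiable (at t)"
  unfolding smooth_on_line_def by (drule spec[of _ 0]) simp

lemma smooth_on_line_deriv: "smooth_on_line J f \<Longrightarrow> smooth_on_line J (deriv f)"
  unfolding smooth_on_line_def by (metis comp_apply funpow_Suc_right)

lemma deriv_cong_open:
  assumes "open J" "\<And>t. t \<in> J \<Longrightarrow> f t = g t" "t \<in> J"
  shows "deriv f t = deriv g t"
  using assms by (intro deriv_cong_ev) (auto simp: eventually_nhds)

lemma higher_deriv_cong_open:
  assumes "open J" "\<And>t. t \<in> J \<Longrightarrow> f t = g t" "t \<in> J"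
  shows "(deriv ^^ k) f t = (deriv ^^ k) g t"
  using assms(3)
proof (induction k arbitrary: t)
  case (Suc k)
  then show ?case using assms(1) by (auto intro: deriv_cong_open)
qed (use assms in simp)

lemma smooth_on_line_cong:
  assumes "open J" "\<And>t. t \<in> J \<Longrightarrow> f t = g t" "smooth_on_line J f"
  shows "smooth_on_line J g"
  unfolding smooth_on_line_def
proof (intro allI ballI)
  fix k t assume t: "t \<in> J"
  then have "((deriv ^^ k) f has_field_derivative deriv ((deriv ^^ k) f) t) (at t)"
    using assms(3) by (simp add: smooth_on_line_def DERIV_deriv_iff_field_differentiable)
  then have "((deriv ^^ k) g has_field_derivative deriv ((deriv ^^ k) f) t) (at t)"
    by (rule has_field_derivative_transform_within_open[OF _ assms(1) t])
       (rule higher_deriv_cong_open[OF assms(1,2)])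
  then show "(deriv ^^ k) g field_differentiable (at t)"
    by (auto simp: field_differentiable_def)
qed

lemma smooth_on_line_const: "smooth_on_line J (\<lambda>t. c)"
proof -
  have "(deriv ^^ k) (\<lambda>t. c) = (\<lambda>t. if k = 0 then c else 0)" for k
    by (induction k) auto
  then show ?thesis by (simp add: smooth_on_line_def)
qed

lemma smooth_on_line_cmult:
  assumes "open J" "smooth_on_line J f"
  shows "smooth_on_line J (\<lambda>t. c * f t)"
proof -
  have *: "(deriv ^^ k) (\<lambda>t. c * f t) t = c * (deriv ^^ k) f t" if "t \<in> J" for k t
    using that
  proof (induction k arbitrary: t)
    case (Suc k)
    then have "deriv ((deriv ^^ k) (\<lambda>t. c * f t)) t = deriv (\<lambda>t. c * (deriv ^^ k) f t) t"
      using assms(1) by (intro deriv_cong_open[of J]) auto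
    with Suc assms(2) show ?case by (simp add: smooth_on_line_def)
  qed simp
  show ?thesis
    unfolding smooth_on_line_def
  proof (intro allI ballI)
    fix k t assume t: "t \<in> J"
    have "((\<lambda>t. c * (deriv ^^ k) f t) has_field_derivative c * deriv ((deriv ^^ k) f) t) (at t)"
      using assms(2) t
      by (intro DERIV_cmult) (simp add: smooth_on_line_def DERIV_deriv_iff_field_differentiable)
    then have "((deriv ^^ k) (\<lambda>t. c * f t) has_field_derivative c * deriv ((deriv ^^ k) f) t) (at t)"
      by (rule has_field_derivative_transform_within_open[OF _ assms(1) t]) (simp add: *)
    then show "(deriv ^^ k) (\<lambda>t. c * f t) field_differentiable (at t)"
      by (auto simp: field_differentiable_def)
  qed
qed

section \<open>Smooth curves and fields along them\<close>

lemma smooth_curve_flat_spaceD: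
  assumes "smooth_curve (flat_space n) I \<gamma>"
  shows "open I" "t \<in> I \<Longrightarrow> \<gamma> t \<in> Rn n" "continuous_on I \<gamma>"
    "{t \<in> I. \<gamma> t \<in> Rn n} = I" "i < n \<Longrightarrow> smooth_on_line I (\<lambda>t. \<gamma> t i)"
proof -
  show I: "open I"
    using assms by (simp add: smooth_curve_def)
  have cont: "continuous_map (top_of_set I) (Euclidean_space n) \<gamma>"
    using assms by (simp add: smooth_curve_def)
  \<comment> \<open>Continuity into the subspace keeps the curve inside the single chart, so the
    chart condition concerns all of I.\<close>
  then have "\<gamma> ` I \<subseteq> Rn n"
    using continuous_map_image_subset_topspace by fastforce
  then show *: "t \<in> I \<Longrightarrow> \<gamma> t \<in> Rn n" and eq: "{t \<in> I. \<gamma> t \<in> Rn n} = I" for t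
    by auto
  show "continuous_on I \<gamma>"
    using cont by (simp add: Euclidean_space_def euclidean_product_topology continuous_map_in_subtopology)
  show "smooth_on_line I (\<lambda>t. \<gamma> t i)" if "i < n"
    using assms that eq by (simp add: smooth_curve_def)
qed

lemma fields_along_flat_space:
  assumes "smooth_curve (flat_space n) I \<gamma>"
  shows "Y \<in> fields_along (flat_space n) I \<gamma> \<longleftrightarrow>
    (\<forall>t\<in>I. Y t = flat_vec n (Y t (std_chart n))) \<and>
    (\<forall>i<n. smooth_on_line I (\<lambda>t. Y t (std_chart n) i))"
proof -
  have "Y t \<in> range (flat_vec n) \<longleftrightarrow> Y t = flat_vec n (Y t (std_chart n))" for t
    by (auto simp: flat_vec_eq_iff)
  then show ?thesis
    using smooth_curve_flat_spaceD(2,4)[OF assms]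
    by (simp add: fields_along_def tangent_space_flat_space)
qed

lemma vector_field_along_in_fields_along:
  assumes "smooth_curve (flat_space n) I \<gamma>"
    and "\<And>i. i < n \<Longrightarrow> smooth_on_line I (\<lambda>t. F i (\<gamma> t))"
  shows "(\<lambda>t. flat_field n F (\<gamma> t)) \<in> fields_along (flat_space n) I \<gamma>"
proof -
  note c = smooth_curve_flat_spaceD[OF assms(1)]
  have "smooth_on_line I (\<lambda>t. flat_field n F (\<gamma> t) (std_chart n) i)" if "i < n" for i
    by (rule smooth_on_line_cong[OF c(1) _ assms(2)[OF that]]) (use c(2) that in simp)
  then show ?thesis
    using c(2) by (simp add: fields_along_flat_space[OF assms(1)] flat_vec_eq_iff)
qed

lemma velocity_flat_space:
  assumes "smooth_curve (flat_space n) I \<gamma>" "t \<in> I"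
  shows "velocity (flat_space n) \<gamma> t = flat_vec n (\<lambda>i. deriv (\<lambda>s. \<gamma> s i) t)"
  using smooth_curve_flat_spaceD(2)[OF assms] by (auto simp: velocity_def flat_vec_def fun_eq_iff)

lemma velocity_in_fields_along:
  assumes "smooth_curve (flat_space n) I \<gamma>"
  shows "velocity (flat_space n) \<gamma> \<in> fields_along (flat_space n) I \<gamma>"
proof -
  note c = smooth_curve_flat_spaceD[OF assms]
  have "smooth_on_line I (\<lambda>t. velocity (flat_space n) \<gamma> t (std_chart n) i)" if "i < n" for i
    by (rule smooth_on_line_cong[OF c(1) _ smooth_on_line_deriv[OF c(5)[OF that]]])
       (use velocity_flat_space[OF assms] that in simp)
  then show ?thesis
    by (simp add: fields_along_flat_space[OF assms] velocity_flat_space[OF assms] flat_vec_eq_iff)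
qed

text \<open>By the chain rule, the derivative of a field in the direction of the velocity is the
  ordinary derivative of its components along the curve. This yields the axiom linking
  differentiation along curves to the connection.\<close>

lemma nabla_at_velocity:
  assumes "smooth_curve (flat_space n) I \<gamma>" "t \<in> I" "\<And>i. i < n \<Longrightarrow> smooth n (G i)"
  shows "nabla_at (flat_space n) (\<gamma> t) (velocity (flat_space n) \<gamma> t) (flat_field n G)
    = flat_vec n (\<lambda>i. deriv (\<lambda>s. G i (\<gamma> s)) t)"
proof -
  note c = smooth_curve_flat_spaceD[OF assms(1)]
  have "((\<lambda>s. \<gamma> s i) has_real_derivative deriv (\<lambda>s. \<gamma> s i) t) (at t)" if "i < n" for i
    using smooth_on_line_imp_differentiable[OF c(5)[OF that] assms(2)]
    by (simp add: DERIV_deriv_iff_field_differentiable)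
  from smooth_chain_rule[OF assms(3) c(1) assms(2) c(2) this c(3)]
  have "deriv (\<lambda>s. G i (\<gamma> s)) t = (\<Sum>j<n. deriv (\<lambda>s. \<gamma> s j) t * partial_deriv j (G i) (\<gamma> t))"
    if "i < n" for i
    using that by (simp add: DERIV_imp_deriv)
  then show ?thesis
    using assms c(2) by (simp add: velocity_flat_space nabla_at_flat_space flat_vec_eq_iff)
qed

section \<open>Covariant differentiation along a curve\<close>

definition flat_cov_deriv ::
    "nat \<Rightarrow> (real \<Rightarrow> (nat \<Rightarrow> real) tvec) \<Rightarrow> real \<Rightarrow> (nat \<Rightarrow> real) tvec" where
  "flat_cov_deriv n Y t = flat_vec n (\<lambda>i. deriv (\<lambda>s. Y s (std_chart n) i) t)"

lemma is_cov_deriv_along_flat_cov_deriv: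
  assumes "smooth_curve (flat_space n) I \<gamma>"
  shows "is_cov_deriv_along (flat_space n) I \<gamma> (flat_cov_deriv n)"
proof -
  note c = smooth_curve_flat_spaceD[OF assms]
  note along = fields_along_flat_space[OF assms]
  have diff: "(\<lambda>s. Y s (std_chart n) i) field_differentiable (at t)"
    if "Y \<in> fields_along (flat_space n) I \<gamma>" "t \<in> I" "i < n" for Y t i
    using that smooth_on_line_imp_differentiable along by metis
  show ?thesis
    unfolding is_cov_deriv_along_def
  proof (intro conjI ballI allI impI)
    fix Y assume Y: "Y \<in> fields_along (flat_space n) I \<gamma>"
    then show "flat_cov_deriv n Y \<in> fields_along (flat_space n) I \<gamma>"
      unfolding along by (auto simp: flat_cov_deriv_def flat_vec_eq_iff intro: smooth_on_line_deriv)
    show "flat_cov_deriv n (Y + Z) t = flat_cov_deriv n Y t + flat_cov_deriv n Z t"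
      if "Z \<in> fields_along (flat_space n) I \<gamma>" "t \<in> I" for Z t
      using diff Y that by (simp add: flat_cov_deriv_def flat_vec_arith flat_vec_eq_iff)
    show "flat_cov_deriv n (\<lambda>s. f s *\<^sub>T Y s) t = f t *\<^sub>T flat_cov_deriv n Y t + deriv f t *\<^sub>T Y t"
      if "smooth_on_line I f" "t \<in> I" for f t
    proof -
      have Yt: "Y t = flat_vec n (Y t (std_chart n))"
        using Y that along by blast
      have "f field_differentiable (at t)"
        using that smooth_on_line_imp_differentiable by blast
      then have "flat_cov_deriv n (\<lambda>s. f s *\<^sub>T Y s) t = f t *\<^sub>T flat_cov_deriv n Y t
          + deriv f t *\<^sub>T flat_vec n (Y t (std_chart n))"
        using diff Y that by (simp add: flat_cov_deriv_def flat_vec_arith flat_vec_eq_iff tscale_apply)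
      with Yt show ?thesis by simp
    qed
  next
    fix X t assume X: "X \<in> vector_fields (flat_space n)" and t: "t \<in> I"
    then obtain F where F: "X = flat_field n F" "\<And>i. i < n \<Longrightarrow> smooth n (F i)"
      by (metis vector_fields_flat_spaceE)
    have "deriv (\<lambda>s. flat_field n F (\<gamma> s) (std_chart n) i) t = deriv (\<lambda>s. F i (\<gamma> s)) t" if "i < n" for i
      by (rule deriv_cong_open[OF c(1) _ t]) (use that c(2) in simp)
    then show "flat_cov_deriv n (\<lambda>s. X (\<gamma> s)) t
        = nabla_at (flat_space n) (\<gamma> t) (velocity (flat_space n) \<gamma> t) X"
      by (simp add: F nabla_at_velocity[OF assms t] flat_cov_deriv_def flat_vec_eq_iff)
  qed
qed

text \<open>Expansion in the parallel coordinate frame.  The components are cut off to 0 outside \<open>I\<close>, where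
  a field along the curve may take arbitrary values, to get an equation between total functions.\<close>

lemma is_cov_deriv_along_flat_space_unique:
  assumes curve: "smooth_curve (flat_space n) I \<gamma>"
    and D: "is_cov_deriv_along (flat_space n) I \<gamma> D"
    and Y: "Y \<in> fields_along (flat_space n) I \<gamma>" and t: "t \<in> I"
  shows "D Y t = flat_cov_deriv n Y t"
proof -
  note c = smooth_curve_flat_spaceD[OF curve]
  note along = fields_along_flat_space[OF curve]
  have D_add: "D (V + W) t = D V t + D W t"
    if "V \<in> fields_along (flat_space n) I \<gamma>" "W \<in> fields_along (flat_space n) I \<gamma>" for V W
    using D that t unfolding is_cov_deriv_along_def by blast
  have D_scale: "D (\<lambda>s. f s *\<^sub>T V s) t = f t *\<^sub>T D V t + deriv f t *\<^sub>T V t"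
    if "V \<in> fields_along (flat_space n) I \<gamma>" "smooth_on_line I f" for f V
    using D that t unfolding is_cov_deriv_along_def by blast
  define \<iota> where "\<iota> s = (if s \<in> I then 1 else 0 :: real)" for s
  define y where "y i s = \<iota> s * Y s (std_chart n) i" for i s
  define e where "e i = flat_field n (\<lambda>j q. if j = i then 1 else 0)" for i
  define P where "P m s = flat_vec n (\<lambda>j. if j < m then y j s else 0)" for m s
  \<comment> \<open>The cutoff is 1 on the open set I, hence near t, so it adds no term to the
    Leibniz rule at t.\<close>
  have \<iota>: "smooth_on_line I \<iota>" "deriv \<iota> t = 0"
  proof -
    show "smooth_on_line I \<iota>"
      by (rule smooth_on_line_cong[OF c(1) _ smooth_on_line_const[of I 1]]) (simp add: \<iota>_def)
    have "deriv \<iota> t = deriv (\<lambda>s. 1) t"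
      by (rule deriv_cong_open[OF c(1) _ t]) (simp add: \<iota>_def)
    then show "deriv \<iota> t = 0" by simp
  qed
  have y: "smooth_on_line I (y i)" "deriv (y i) t = deriv (\<lambda>s. Y s (std_chart n) i) t" if "i < n" for i
  proof -
    have "smooth_on_line I (\<lambda>s. Y s (std_chart n) i)"
      using Y that along by blast
    then show "smooth_on_line I (y i)"
      by (rule smooth_on_line_cong[OF c(1), rotated]) (simp add: y_def \<iota>_def)
    show "deriv (y i) t = deriv (\<lambda>s. Y s (std_chart n) i) t"
      by (rule deriv_cong_open[OF c(1) _ t]) (simp add: y_def \<iota>_def)
  qed
  have e: "(\<lambda>s. e i (\<gamma> s)) \<in> fields_along (flat_space n) I \<gamma>" "D (\<lambda>s. e i (\<gamma> s)) t = 0" for i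
  proof -
    show "(\<lambda>s. e i (\<gamma> s)) \<in> fields_along (flat_space n) I \<gamma>"
      unfolding e_def by (rule vector_field_along_in_fields_along[OF curve smooth_on_line_const])
    have "e i \<in> vector_fields (flat_space n)"
      unfolding e_def by (rule flat_field_in_vector_fields) simp
    then have "D (\<lambda>s. e i (\<gamma> s)) t = nabla_at (flat_space n) (\<gamma> t) (velocity (flat_space n) \<gamma> t) (e i)"
      using D t unfolding is_cov_deriv_along_def by blast
    also have "\<dots> = flat_vec n (\<lambda>j. deriv (\<lambda>s. if j = i then 1 else 0) t)"
      unfolding e_def by (rule nabla_at_velocity[OF curve t]) simp
    finally show "D (\<lambda>s. e i (\<gamma> s)) t = 0" by simp
  qed
  have P_in: "P m \<in> fields_along (flat_space n) I \<gamma>" for m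
    unfolding along
  proof (intro conjI ballI allI impI)
    show "smooth_on_line I (\<lambda>s. P m s (std_chart n) i)" if "i < n" for i
      using y(1)[OF that] smooth_on_line_const that by (cases "i < m") (simp_all add: P_def)
  qed (simp add: P_def flat_vec_eq_iff)
  have "D (P m) t = flat_vec n (\<lambda>j. if j < m then deriv (y j) t else 0)" if "m \<le> n" for m
    using that
  proof (induction m)
    case 0
    \<comment> \<open>Scaling by the constant 0 extracts \<open>D 0 = 0\<close> from the Leibniz
      axiom.\<close>
    have "P 0 = (\<lambda>s. 0 *\<^sub>T P 0 s)"
      by (simp add: P_def fun_eq_iff tscale_def)
    then have "D (P 0) t = D (\<lambda>s. 0 *\<^sub>T P 0 s) t"
      by simp
    also have "\<dots> = 0 *\<^sub>T D (P 0) t + deriv (\<lambda>s. 0) t *\<^sub>T P 0 t"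
      by (rule D_scale[OF P_in smooth_on_line_const])
    also have "\<dots> = 0"
      by (simp add: tscale_def fun_eq_iff)
    finally show ?case by simp
  next
    case (Suc m)
    \<comment> \<open>The m-th summand of the frame expansion. Since \<open>D\<close> kills the
      frame field, the Leibniz rule leaves only the derivative of the coefficient.\<close>
    define Q where "Q s = y m s *\<^sub>T e m (\<gamma> s)" for s
    have Q: "Q s = flat_vec n (\<lambda>j. if j = m then y m s else 0)" for s
    proof (cases "s \<in> I")
      case True
      then show ?thesis using c(2) by (simp add: Q_def e_def flat_vec_arith flat_vec_eq_iff)
    next
      case False
      then show ?thesis
        by (simp add: Q_def y_def \<iota>_def tscale_def fun_eq_iff flat_vec_def)
    qed
    have "P (Suc m) = P m + Q"
      by (rule ext) (auto simp: P_def Q flat_vec_arith flat_vec_eq_iff less_Suc_eq)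
    moreover have Q_in: "Q \<in> fields_along (flat_space n) I \<gamma>"
      unfolding along
    proof (intro conjI ballI allI impI)
      show "smooth_on_line I (\<lambda>s. Q s (std_chart n) i)" if "i < n" for i
        using y(1) smooth_on_line_const that by (cases "i = m") (simp_all add: Q)
    qed (simp add: Q flat_vec_eq_iff)
    moreover have "D Q t = flat_vec n (\<lambda>j. if j = m then deriv (y m) t else 0)"
      using D_scale[OF e(1) y(1), of m m] e(2)[of m] Suc.prems c(2)[OF t]
      by (simp add: Q_def[abs_def] e_def flat_vec_arith flat_vec_eq_iff if_distrib cong: if_cong)
    ultimately have "D (P (Suc m)) t = flat_vec n (\<lambda>j. if j < m then deriv (y j) t else 0)
        + flat_vec n (\<lambda>j. if j = m then deriv (y m) t else 0)"
      using Suc D_add[OF P_in Q_in] by (simp only: Suc_leD)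
    then show ?case
      by (auto simp: flat_vec_arith flat_vec_eq_iff less_Suc_eq)
  qed
  from this[of n] have "D (P n) t = flat_cov_deriv n Y t"
    using y(2) by (simp add: flat_cov_deriv_def flat_vec_eq_iff)
  moreover have "P n = (\<lambda>s. \<iota> s *\<^sub>T Y s)"
  proof
    fix s
    show "P n s = \<iota> s *\<^sub>T Y s"
    proof (cases "s \<in> I")
      case True
      then have "Y s = flat_vec n (Y s (std_chart n))"
        using Y along by blast
      moreover have "P n s = \<iota> s *\<^sub>T flat_vec n (Y s (std_chart n))"
        by (simp add: P_def y_def flat_vec_arith flat_vec_eq_iff)
      ultimately show ?thesis by simp
    next
      case False
      then show ?thesis
        by (simp add: P_def y_def \<iota>_def tscale_def fun_eq_iff flat_vec_def)
    qed
  qed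
  \<comment> \<open>The Leibniz rule carries the result from the cut-off field back to
    \<open>Y\<close>, although the two may differ outside I.\<close>
  moreover have "D (\<lambda>s. \<iota> s *\<^sub>T Y s) t = D Y t"
    using D_scale[OF Y \<iota>(1)] t by (simp add: \<iota>(2)) (simp add: \<iota>_def tscale_def fun_eq_iff)
  ultimately show ?thesis by simp
qed

text \<open>The second claim allows the operator to be applied again, as the Jacobi equation
  requires.\<close>

lemma cov_deriv_along_flat_space:
  assumes "smooth_curve (flat_space n) I \<gamma>"
    and "Y \<in> fields_along (flat_space n) I \<gamma>"
  shows "t \<in> I \<Longrightarrow> cov_deriv_along (flat_space n) I \<gamma> Y t
      = flat_vec n (\<lambda>i. deriv (\<lambda>s. Y s (std_chart n) i) t)"
    and "cov_deriv_along (flat_space n) I \<gamma> Y \<in> fields_along (flat_space n) I \<gamma>"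
proof -
  let ?D = "cov_deriv_along (flat_space n) I \<gamma>"
  have D: "is_cov_deriv_along (flat_space n) I \<gamma> ?D"
    unfolding cov_deriv_along_def
    by (rule someI[of "is_cov_deriv_along (flat_space n) I \<gamma>",
          OF is_cov_deriv_along_flat_cov_deriv[OF assms(1)]])
  show "t \<in> I \<Longrightarrow> ?D Y t = flat_vec n (\<lambda>i. deriv (\<lambda>s. Y s (std_chart n) i) t)"
    using is_cov_deriv_along_flat_space_unique[OF assms(1) D assms(2)]
    by (simp add: flat_cov_deriv_def)
  show "?D Y \<in> fields_along (flat_space n) I \<gamma>"
    using D assms(2) unfolding is_cov_deriv_along_def by blast
qed


section \<open>Diagonal linear vector fields\<close>

definition diag_field :: "nat \<Rightarrow> (nat \<Rightarrow> real) \<Rightarrow> (nat \<Rightarrow> real) vfield" where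
  "diag_field n a = flat_field n (\<lambda>i p. a i * p i)"

lemma diag_field_in_vector_fields: "diag_field n a \<in> vector_fields (flat_space n)"
  unfolding diag_field_def by (rule flat_field_in_vector_fields) (simp add: smooth_mult)

lemma partial_deriv_diag:
  "partial_deriv j (\<lambda>p. c * p i) p = (if i = j then c else 0)"
  by (auto simp: partial_deriv_def)

text \<open>Geodesics have constant velocity, so a linear field is affine along them, and there is no
  curvature term.\<close>

lemma global_jacobi_diag_field: "global_jacobi (flat_space n) (diag_field n a)"
  unfolding global_jacobi_def
proof (intro allI impI)
  fix I \<gamma> assume "geodesic (flat_space n) I \<gamma>"
  then have curve: "smooth_curve (flat_space n) I \<gamma>"
    and geo: "\<And>t. t \<in> I \<Longrightarrow> cov_deriv_along (flat_space n) I \<gamma> (velocity (flat_space n) \<gamma>) t = 0"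
    by (auto simp: geodesic_def)
  note c = smooth_curve_flat_spaceD[OF curve]
  let ?v = "\<lambda>i. deriv (\<lambda>s. \<gamma> s i)"
  let ?J = "\<lambda>t. diag_field n a (\<gamma> t)"
  let ?D = "cov_deriv_along (flat_space n) I \<gamma>"
  have acc: "deriv (?v i) t = 0" if "t \<in> I" "i < n" for t i
  proof -
    have "deriv (\<lambda>s. velocity (flat_space n) \<gamma> s (std_chart n) i) t = deriv (?v i) t"
      by (rule deriv_cong_open[OF c(1) _ that(1)]) (use that velocity_flat_space[OF curve] in simp)
    then show ?thesis
      using geo[OF that(1)] that
      by (simp add: cov_deriv_along_flat_space[OF curve velocity_in_fields_along[OF curve]]
          flat_vec_eq_0_iff)
  qed
  have J: "?J \<in> fields_along (flat_space n) I \<gamma>"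
    unfolding diag_field_def
    by (rule vector_field_along_in_fields_along[OF curve]) (intro smooth_on_line_cmult c)
  have DJ: "?D ?J t = flat_vec n (\<lambda>i. a i * ?v i t)" if "t \<in> I" for t
  proof -
    have "deriv (\<lambda>s. ?J s (std_chart n) i) t = a i * ?v i t" if "i < n" for i
    proof -
      have "deriv (\<lambda>s. ?J s (std_chart n) i) t = deriv (\<lambda>s. a i * \<gamma> s i) t"
        by (rule deriv_cong_open[OF c(1) _ \<open>t \<in> I\<close>]) (use that c(2) in \<open>simp add: diag_field_def\<close>)
      then show ?thesis
        using smooth_on_line_imp_differentiable[OF c(5)[OF that] \<open>t \<in> I\<close>] by simp
    qed
    then show ?thesis
      using that by (simp add: cov_deriv_along_flat_space[OF curve J] flat_vec_eq_iff)
  qed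
  have DDJ: "?D (?D ?J) t = 0" if "t \<in> I" for t
  proof -
    have "deriv (\<lambda>s. ?D ?J s (std_chart n) i) t = 0" if "i < n" for i
    proof -
      \<comment> \<open>The first covariant derivative is known only on I; openness of I makes that
        enough for differentiating once more.\<close>
      have "deriv (\<lambda>s. ?D ?J s (std_chart n) i) t = deriv (\<lambda>s. a i * ?v i s) t"
        by (rule deriv_cong_open[OF c(1) _ \<open>t \<in> I\<close>]) (use that DJ in simp)
      then show ?thesis
        using smooth_on_line_imp_differentiable[OF smooth_on_line_deriv[OF c(5)[OF that]] \<open>t \<in> I\<close>]
          acc[OF \<open>t \<in> I\<close> that] by simp
    qed
    then show ?thesis
      using that
      by (simp add: cov_deriv_along_flat_space(1)[OF curve cov_deriv_along_flat_space(2)[OF curve J]]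
          flat_vec_eq_0_iff)
  qed
  show "jacobi_field_along (flat_space n) I \<gamma> ?J"
    unfolding jacobi_field_along_def
    using J DDJ c(2)
    by (simp add: velocity_flat_space[OF curve] diag_field_def curvature_at_flat_space)
qed

section \<open>Divergence and Lie derivative of the metric\<close>

lemma divergence_diag_field:
  assumes "p \<in> Rn n"
  shows "divergence (flat_space n) (diag_field n a) p = (\<Sum>i<n. a i)"
proof -
  have "nabla_at (flat_space n) p (coord_vec (flat_space n) (std_chart n) i p) (diag_field n a)
      (std_chart n) i = a i" if "i < n" for i
  proof -
    have "(\<Sum>j<n. (if j = i then 1 else 0) * partial_deriv j (\<lambda>p. a i * p i) p)
        = (\<Sum>j<n. if i = j then a i else 0)"
      by (rule sum.cong) (auto simp: partial_deriv_diag)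
    with that assms show ?thesis
      by (simp add: coord_vec_flat_space diag_field_def nabla_at_flat_space smooth_mult)
  qed
  with assms show ?thesis by (simp add: divergence_def tangent_trace_def)
qed

text \<open>The divergence is the trace at every point, and the space is nonempty, so vanishing
  everywhere is a condition on the trace alone.\<close>

lemma solenoidal_diag_field_iff:
  "solenoidal (flat_space n) (diag_field n a) \<longleftrightarrow> (\<Sum>i<n. a i) = 0"
  using divergence_diag_field[of "\<lambda>i. 0" n a]
  by (auto simp: solenoidal_def divergence_diag_field nontrivial_Euclidean_space)

text \<open>Test against the k-th coordinate field E. Its length is constant and
  \<open>[X, E] = - a k E\<close>, so the two bracket terms give
  \<open>(L_X g)(E, E) = 2 * a k\<close>. The origin serves as the point of evaluation.\<close>

lemma not_killing_diag_field:
  assumes "k < n" "a k \<noteq> 0"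
  shows "\<not> killing (flat_space n) (diag_field n a)"
proof
  assume killing: "killing (flat_space n) (diag_field n a)"
  define E where "E = (\<lambda>i (q :: nat \<Rightarrow> real). if i = k then 1 else 0 :: real)"
  define p :: "nat \<Rightarrow> real" where "p = (\<lambda>i. 0)"
  have p: "p \<in> Rn n" by (simp add: p_def topspace_Euclidean_space)
  have E: "flat_field n E \<in> vector_fields (flat_space n)"
    by (rule flat_field_in_vector_fields) (simp add: E_def)
  have "dir_deriv (flat_space n) p (diag_field n a p)
      (\<lambda>q. mmetric (flat_space n) q (flat_field n E q) (flat_field n E q))
    = deriv_in_direction n (\<lambda>i p. a i * p i) (\<lambda>q. \<Sum>i<n. E i p * E i p) p"
    unfolding diag_field_def dir_deriv_flat_space[OF p]
    by (rule deriv_in_direction_cong) (use p in \<open>auto simp: E_def\<close>)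
  also have "\<dots> = 0" by (simp add: deriv_in_direction_def partial_deriv_def)
  finally have 1: "dir_deriv (flat_space n) p (diag_field n a p)
      (\<lambda>q. mmetric (flat_space n) q (flat_field n E q) (flat_field n E q)) = 0" .
  have 2: "lie_bracket (flat_space n) (diag_field n a) (flat_field n E) p
      = flat_vec n (\<lambda>i. - (if i = k then a k else 0))"
  proof -
    have "deriv_in_direction n E (\<lambda>p. a i * p i) p = (\<Sum>j<n. if k = j then (if i = j then a i else 0) else 0)" for i
      unfolding deriv_in_direction_def E_def by (rule sum.cong) (auto simp: partial_deriv_diag)
    moreover have "deriv_in_direction n (\<lambda>i p. a i * p i) (E i) p = 0" for i
      by (simp add: deriv_in_direction_def partial_deriv_def E_def)
    ultimately show ?thesis
      using p assms by (simp add: diag_field_def lie_bracket_flat_field flat_vec_eq_iff)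
  qed
  have 3: "(\<Sum>i<n. - (if i = k then a k else 0) * E i p) = - a k"
    "(\<Sum>i<n. E i p * - (if i = k then a k else 0)) = - a k"
    using assms by (simp_all add: E_def if_distrib if_distribR sum_negf cong: if_cong)
  have "lie_deriv_metric (flat_space n) (diag_field n a) (flat_field n E) (flat_field n E) p = 2 * a k"
    unfolding lie_deriv_metric_def 1 2 using p 3 by simp
  moreover have "lie_deriv_metric (flat_space n) (diag_field n a) (flat_field n E) (flat_field n E) p = 0"
    using killing E p by (simp add: killing_def)
  ultimately show False using assms by simp
qed

lemma noncompact_flat_space: "n > 0 \<Longrightarrow> noncompact_riemannian_manifold (flat_space n)"
  by (simp add: noncompact_riemannian_manifold_def riemannian_manifold_flat_space
      not_compact_space_Euclidean_space)

theorem theoremB: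
  shows "(\<exists>(M :: riem) X. noncompact_riemannian_manifold M \<and> X \<in> vector_fields M \<and>
             global_jacobi M X \<and> \<not> solenoidal M X) \<and>
         (\<exists>(M :: riem) X. noncompact_riemannian_manifold M \<and> X \<in> vector_fields M \<and>
             global_jacobi M X \<and> solenoidal M X \<and> \<not> killing M X)"
proof (intro conjI exI)
  let ?M = "flat_space 2"
  let ?X = "diag_field 2 (\<lambda>i. 1)" and ?Y = "diag_field 2 (\<lambda>i. if i = 0 then 1 else -1)"
  show "noncompact_riemannian_manifold ?M" "noncompact_riemannian_manifold ?M"
    by (simp_all add: noncompact_flat_space)
  show "?X \<in> vector_fields ?M" "?Y \<in> vector_fields ?M"
    by (rule diag_field_in_vector_fields)+
  show "global_jacobi ?M ?X" "global_jacobi ?M ?Y"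
    by (rule global_jacobi_diag_field)+
  \<comment> \<open>The traces are 1 + 1 = 2 and 1 - 1 = 0.\<close>
  show "\<not> solenoidal ?M ?X" "solenoidal ?M ?Y"
    by (simp_all add: solenoidal_diag_field_iff numeral_2_eq_2)
  show "\<not> killing ?M ?Y"
    by (rule not_killing_diag_field[of 0]) simp_all
qed

end
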